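(* There exists a constant $C_p\ge 1$ depending only on $p$ (the dimensions $d,m$ and the norms being fixed) such that the following holds. Let $f:\mathbb R^d\to\mathbb R^d$ be locally Lipschitz, let $g\in C^3_b(\mathbb R^d,\mathbb R^{d\times m})$ with $C_g:=\max\{\|g\|_\infty,\|Dg\|_\infty,\|D^2g\|_\infty,\|D^3g\|_\infty\}>0$, and let $V$ be a strong Lyapunov function for $f$ (growth type, see context) with parameters $L_V,\lambda_0,C_{\lambda_0},\delta>0$. Let $\lambda>0$ and $M>0$ satisfy $$\lambda\le \tfrac18,\qquad 4\lambda+\frac{1+4\lambda}{M}\le\lambda_0 .$$ Then for every rough path $\mathbf x=(x,\mathbb X)$ and every $y_0\in\mathbb R^d$, the solution $y$ of the tamed scheme $$y_{t_{k+1}}=y_{t_k}+\frac{f(y_{t_k})(t_{k+1}-t_k)}{1+M\|f(y_{t_k})\|(t_{k+1}-t_k)}+g(y_{t_k})x_{t_k,t_{k+1}}+Dg(y_{t_k})g(y_{t_k})\mathbb X_{t_k,t_{k+1}},\quad k\in\mathbb N,$$ on $\Pi=\{t_k\}_{k\in\mathbb N}$ satisfies $$V(y_t)+\bar C\le e^{\delta t}\big[V(y_0)+\bar C+H(\mathbf x,\Pi[0,t])\big],\qquad\forall t\in\Pi,$$ where $\bar C:=\frac{C_{\lambda_0}}{\delta}+L_V\lambda_0$ and $$H(\mathbf x,\Pi[0,t])=L_V\Big(4\lambda+C_g\|\Delta\mathbf x\|_{\infty,\Pi[0,t]}+C_g^2\|\Delta\mathbf x\|^2_{\infty,\Pi[0,t]}\Big)\,N\Big(\frac{\lambda}{C_pC_g},\mathbf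 x,\Pi[0,t]\Big).$$
   Context: Fix $\nu\in(\frac13,\frac12]$, $p\in(\frac1\nu,3)$ and $q=p/2$. A rough path $\mathbf x=(x,\mathbb X)$ consists of a path $x$ with values in $\mathbb R^m$ and a two-parameter function $\mathbb X$ with values in $\mathbb R^m\otimes\mathbb R^m$, which on compact intervals are $\frac1p$-Hölder and $\frac2p$-Hölder respectively ($\sup_{s<t}\|\mathbb X_{s,t}\|/|t-s|^{2/p}<\infty$), satisfying Chen's relation $\mathbb X_{s,t}-\mathbb X_{s,u}-\mathbb X_{u,t}=x_{s,u}\otimes x_{u,t}$ for $s\le u\le t$, where $x_{s,t}:=x_t-x_s$. Time grid: $\Pi=\{t_k\}_{k\in\mathbb N}$ is a discrete time set, $0=t_0<t_1<\cdots$, $t_k\to\infty$, with $|\Pi|:=\sup_k|t_{k+1}-t_k|\in(0,1)$; $\Pi[s,t]:=\Pi\cap[s,t]$. Discrete $p$-variation: $|||x|||_{p\text{-var},\Pi[s,t]}=(\sup\sum_i\|x_{s_i,s_{i+1}}\|^p)^{1/p}$ and $|||\mathbb X|||_{q\text{-var},\Pi[s,t]}=(\sup\sum_i\|\mathbb X_{s_i,s_{i+1}}\|^q)^{1/q}$, suprema over all finite sequences $s=s_0<\dots<s_n=t$ in $\Pi[s,t]$; $|||\mathbf x|||_{p\text{-var},\Pi[s,t]}=\big(|||x|||^p_{p\text{-var},\Pi[s,t]}+|||\mathbb X|||^q_{q\text{-var},\Pi[s,t]}\big)^{1/p}$. Also $\|\mathbf x_{s,t}\|:=(\|x_{s,t}\|^p+\|\mathbb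 X_{s,t}\|^q)^{1/p}$ and $\|\Delta\mathbf x\|_{\infty,\Pi[s,t]}:=\max\{\|\mathbf x_{t_k,t_{k+1}}\|: s\le t_k<t\}$ (equal to $0$ if $s=t$). Discrete stopping times for $\gamma>0$ on $\Pi[0,t]$: $\tau_0=0$; if $\tau_n=t_k<t$, then $\tau_{n+1}=t_{k+1}$ if $|||\mathbf x|||_{p\text{-var},\Pi[t_k,t_{k+1}]}>\gamma$, and otherwise $\tau_{n+1}=\max\{t_l\in\Pi[0,t]: t_l>t_k,\ |||\mathbf x|||_{p\text{-var},\Pi[t_k,t_l]}\le\gamma\}$. $N(\gamma,\mathbf x,\Pi[0,t])$ is the number of these stopping times, i.e. the index $N$ with $\tau_N=t$. Function classes: $\mathcal K'_\infty$ is the set of continuous strictly increasing $\kappa:\mathbb R_+\to\mathbb R_+$ with $\kappa(t)\to\infty$; $\mathcal K^{\rm tempered}_\infty$ is the set of $\kappa\in\mathcal K'_\infty$ with $\limsup_{\epsilon\to0}\limsup_{t\to\infty}\frac1t\log\kappa(e^{\epsilon t})=0$. Strong Lyapunov function for $f$ (growth type): $V\in C^1(\mathbb R^d,\mathbb R_+)$ such that (1) there are $\alpha,\beta\in\mathcal K^{\rm tempered}_\infty$ with $\alpha^{-1}\in\mathcal K^{\rm tempered}_\infty$ (for $\alpha(0)>0$, $\alpha^{-1}$ is understood on the range of $\alpha$ and the condition concerns its growth) and $\alpha(\|z\|)\le V(z)\le\beta(\|z\|)$ for all $z$; (2) $\|\nabla V(z)\|\le L_V$ for all $z$, for a constant $L_V>0$;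 (3) there are $\lambda_0\in(0,1)$ and $C_{\lambda_0},\delta>0$ with $$\sup_{\|\psi\|\le\lambda_0,\ \|\eta\|\le\lambda_0}\langle\nabla V(z),(I+\psi)f(z+\eta)\rangle\le C_{\lambda_0}+\delta V(z)\quad\forall z\in\mathbb R^d,$$ the supremum being over $\psi\in\mathbb R^{d\times d}$, $\eta\in\mathbb R^d$. *)

theory Defs
  imports "HOL-Analysis.Analysis"
begin

(* Norms: vectors, d x m matrices and elements of R^m (x) R^m (represented as m x m matrices)
   carry the library's Euclidean (Frobenius) norm; derivatives of g carry the induced operator
   norms.  With this choice |g(y) a| <= |g(y)| |a| and |Dg(y)g(y)A| <= |Dg(y)| |g(y)| |A| hold
   without dimensional factors; the second would fail if g(y) and Dg(y) were both measured in
   operator norm but A in the Euclidean norm. *)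

section \<open>Rough paths\<close>

definition tensor :: "real^'m \<Rightarrow> real^'m \<Rightarrow> real^'m^'m" where
  "tensor a b = (\<chi> i j. a $ i * b $ j)"

definition incr :: "(real \<Rightarrow> 'a::real_normed_vector) \<Rightarrow> real \<Rightarrow> real \<Rightarrow> 'a" where
  "incr x s t = x t - x s"

(* Time runs over [0, oo). *)
definition holder2_on_compacts ::
    "real \<Rightarrow> (real \<Rightarrow> real \<Rightarrow> 'a::real_normed_vector) \<Rightarrow> bool" where
  "holder2_on_compacts h Z \<longleftrightarrow>
     (\<forall>a b. 0 \<le> a \<longrightarrow>
        (\<exists>C. \<forall>s t. a \<le> s \<and> s < t \<and> t \<le> b \<longrightarrow> norm (Z s t) / (t - s) powr h \<le> C))"

definition rough_path ::
    "real \<Rightarrow> (real \<Rightarrow> real^'m) \<Rightarrow> (real \<Rightarrow> real \<Rightarrow> real^'m^'m) \<Rightarrow> bool" where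
  "rough_path p x X \<longleftrightarrow>
     holder2_on_compacts (1/p) (incr x) \<and>
     holder2_on_compacts (2/p) X \<and>
     (\<forall>s u t. 0 \<le> s \<and> s \<le> u \<and> u \<le> t \<longrightarrow>
        X s t - X s u - X u t = tensor (incr x s u) (incr x u t))"

section \<open>Time grids and discrete variation\<close>

definition mesh :: "(nat \<Rightarrow> real) \<Rightarrow> real" where
  "mesh ts = (SUP k. \<bar>ts (Suc k) - ts k\<bar>)"

definition time_grid :: "(nat \<Rightarrow> real) \<Rightarrow> bool" where
  "time_grid ts \<longleftrightarrow>
     ts 0 = 0 \<and> strict_mono ts \<and> filterlim ts at_top sequentially \<and>
     bdd_above (range (\<lambda>k. \<bar>ts (Suc k) - ts k\<bar>)) \<and> 0 < mesh ts \<and> mesh ts < 1"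

definition partitions :: "real set \<Rightarrow> real \<Rightarrow> real \<Rightarrow> (nat \<times> (nat \<Rightarrow> real)) set" where
  "partitions G s t =
     {(n, \<sigma>). \<sigma> 0 = s \<and> \<sigma> n = t \<and> (\<forall>i<n. \<sigma> i < \<sigma> (Suc i)) \<and> (\<forall>i\<le>n. \<sigma> i \<in> G \<inter> {s..t})}"

definition dvar ::
    "real \<Rightarrow> (real \<Rightarrow> real \<Rightarrow> 'a::real_normed_vector) \<Rightarrow> real set \<Rightarrow> real \<Rightarrow> real \<Rightarrow> real" where
  "dvar r Z G s t =
     (SUP (n, \<sigma>) \<in> partitions G s t. \<Sum>i<n. norm (Z (\<sigma> i) (\<sigma> (Suc i))) powr r) powr (1/r)"

definition rough_dvar ::
    "real \<Rightarrow> (real \<Rightarrow> real^'m) \<Rightarrow> (real \<Rightarrow> real \<Rightarrow> real^'m^'m) \<Rightarrow> real set \<Rightarrow> real \<Rightarrow> real \<Rightarrow> real"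
  where
  "rough_dvar p x X G s t =
     (dvar p (incr x) G s t powr p + dvar (p/2) X G s t powr (p/2)) powr (1/p)"

definition rough_norm ::
    "real \<Rightarrow> (real \<Rightarrow> real^'m) \<Rightarrow> (real \<Rightarrow> real \<Rightarrow> real^'m^'m) \<Rightarrow> real \<Rightarrow> real \<Rightarrow> real" where
  "rough_norm p x X s t = (norm (incr x s t) powr p + norm (X s t) powr (p/2)) powr (1/p)"

definition max_jump ::
    "real \<Rightarrow> (real \<Rightarrow> real^'m) \<Rightarrow> (real \<Rightarrow> real \<Rightarrow> real^'m^'m) \<Rightarrow> (nat \<Rightarrow> real) \<Rightarrow> real \<Rightarrow> real \<Rightarrow> real"
  where
  "max_jump p x X ts s t =
     (if s = t then 0
      else Max {rough_norm p x X (ts k) (ts (Suc k)) | k. s \<le> ts k \<and> ts k < t})"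

section \<open>Discrete stopping times\<close>

(* Stopping times on [0, ts K], recorded by grid index: the n-th stopping time is
   ts (stop_idx p x X ts K \<gamma> n).  Once K is reached the sequence stays there. *)
definition next_stop ::
    "real \<Rightarrow> (real \<Rightarrow> real^'m) \<Rightarrow> (real \<Rightarrow> real \<Rightarrow> real^'m^'m) \<Rightarrow> (nat \<Rightarrow> real) \<Rightarrow> nat \<Rightarrow> real
      \<Rightarrow> nat \<Rightarrow> nat" where
  "next_stop p x X ts K \<gamma> k =
     (if k \<ge> K then k
      else if rough_dvar p x X (range ts) (ts k) (ts (Suc k)) > \<gamma> then Suc k
      else Max {l. k < l \<and> l \<le> K \<and> rough_dvar p x X (range ts) (ts k) (ts l) \<le> \<gamma>})"

primrec stop_idx ::
    "real \<Rightarrow> (real \<Rightarrow> real^'m) \<Rightarrow> (real \<Rightarrow> real \<Rightarrow> real^'m^'m) \<Rightarrow> (nat \<Rightarrow> real) \<Rightarrow> nat \<Rightarrow> real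
      \<Rightarrow> nat \<Rightarrow> nat" where
  "stop_idx p x X ts K \<gamma> 0 = 0"
| "stop_idx p x X ts K \<gamma> (Suc n) = next_stop p x X ts K \<gamma> (stop_idx p x X ts K \<gamma> n)"

definition stop_count ::
    "real \<Rightarrow> (real \<Rightarrow> real^'m) \<Rightarrow> (real \<Rightarrow> real \<Rightarrow> real^'m^'m) \<Rightarrow> (nat \<Rightarrow> real) \<Rightarrow> nat \<Rightarrow> real
      \<Rightarrow> nat" where
  "stop_count p x X ts K \<gamma> = (LEAST n. stop_idx p x X ts K \<gamma> n = K)"

section \<open>Comparison functions and Lyapunov functions\<close>

(* The parameter a is the left end point of the domain [a, oo); a = 0 gives the classes on R_+,
   a > 0 is needed only for inverses of functions with positive value at 0. *)
definition K_infty' :: "real \<Rightarrow> (real \<Rightarrow> real) \<Rightarrow> bool" where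
  "K_infty' a \<kappa> \<longleftrightarrow>
     continuous_on {a..} \<kappa> \<and> strict_mono_on {a..} \<kappa> \<and> \<kappa> ` {a..} \<subseteq> {0..} \<and>
     filterlim \<kappa> at_top at_top"

definition K_infty_tempered :: "real \<Rightarrow> (real \<Rightarrow> real) \<Rightarrow> bool" where
  "K_infty_tempered a \<kappa> \<longleftrightarrow>
     K_infty' a \<kappa> \<and>
     Limsup (at_right 0)
       (\<lambda>\<epsilon>::real. Limsup at_top (\<lambda>t::real. ereal (1 / t * ln (\<kappa> (exp (\<epsilon> * t)))))) = 0"

definition strong_lyapunov ::
    "(real^'d \<Rightarrow> real^'d) \<Rightarrow> (real^'d \<Rightarrow> real) \<Rightarrow> real \<Rightarrow> real \<Rightarrow> real \<Rightarrow> real \<Rightarrow> bool" where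
  "strong_lyapunov f V L_V lam\<^sub>0 C\<^sub>0 \<delta> \<longleftrightarrow>
     0 < L_V \<and> 0 < lam\<^sub>0 \<and> lam\<^sub>0 < 1 \<and> 0 < C\<^sub>0 \<and> 0 < \<delta> \<and>
     (\<forall>z. 0 \<le> V z) \<and>
     (\<exists>\<alpha> \<beta>. K_infty_tempered 0 \<alpha> \<and> K_infty_tempered 0 \<beta> \<and>
        K_infty_tempered (\<alpha> 0) (inv_into {0..} \<alpha>) \<and>
        (\<forall>z. \<alpha> (norm z) \<le> V z \<and> V z \<le> \<beta> (norm z))) \<and>
     (\<exists>gradV. (\<forall>z. GDERIV V z :> gradV z) \<and> continuous_on UNIV gradV \<and>
        (\<forall>z. norm (gradV z) \<le> L_V) \<and>
        (\<forall>z. \<forall>\<psi> :: real^'d^'d. \<forall>\<eta>. norm \<psi> \<le> lam\<^sub>0 \<and> norm \<eta> \<le> lam\<^sub>0 \<longrightarrow>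
           inner (gradV z) ((mat 1 + \<psi>) *v f (z + \<eta>)) \<le> C\<^sub>0 + \<delta> * V z))"

section \<open>Coefficients and the tamed scheme\<close>

definition locally_lipschitz :: "('a::metric_space \<Rightarrow> 'b::metric_space) \<Rightarrow> bool" where
  "locally_lipschitz f \<longleftrightarrow> (\<forall>z. \<exists>r>0. \<exists>L. L-lipschitz_on (ball z r) f)"

definition C3_bounded ::
    "('a::real_normed_vector \<Rightarrow> 'b::real_normed_vector) \<Rightarrow> ('a \<Rightarrow> 'a \<Rightarrow>\<^sub>L 'b) \<Rightarrow>
     ('a \<Rightarrow> 'a \<Rightarrow>\<^sub>L 'a \<Rightarrow>\<^sub>L 'b) \<Rightarrow> ('a \<Rightarrow> 'a \<Rightarrow>\<^sub>L 'a \<Rightarrow>\<^sub>L 'a \<Rightarrow>\<^sub>L 'b) \<Rightarrow> bool" where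
  "C3_bounded g Dg D2g D3g \<longleftrightarrow>
     (\<forall>z. (g has_derivative blinfun_apply (Dg z)) (at z)) \<and>
     (\<forall>z. (Dg has_derivative blinfun_apply (D2g z)) (at z)) \<and>
     (\<forall>z. (D2g has_derivative blinfun_apply (D3g z)) (at z)) \<and>
     continuous_on UNIV D3g \<and>
     bounded (range g) \<and> bounded (range Dg) \<and> bounded (range D2g) \<and> bounded (range D3g)"

definition sup_norm :: "('a \<Rightarrow> 'b::real_normed_vector) \<Rightarrow> real" where
  "sup_norm h = (SUP z. norm (h z))"

definition C3_const ::
    "('a::real_normed_vector \<Rightarrow> 'b::real_normed_vector) \<Rightarrow> ('a \<Rightarrow> 'a \<Rightarrow>\<^sub>L 'b) \<Rightarrow>
     ('a \<Rightarrow> 'a \<Rightarrow>\<^sub>L 'a \<Rightarrow>\<^sub>L 'b) \<Rightarrow> ('a \<Rightarrow> 'a \<Rightarrow>\<^sub>L 'a \<Rightarrow>\<^sub>L 'a \<Rightarrow>\<^sub>L 'b) \<Rightarrow> real" where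
  "C3_const g Dg D2g D3g = Max {sup_norm g, sup_norm Dg, sup_norm D2g, sup_norm D3g}"

(* Dg(y)g(y)A: the linear extension to A in R^m (x) R^m of  a (x) b |-> (Dg(y)[g(y) a]) b.
   The first tensor slot is the earlier increment, as in Chen's relation. *)
definition second_order ::
    "(real^'d \<Rightarrow> real^'m^'d) \<Rightarrow> (real^'d \<Rightarrow> (real^'d) \<Rightarrow>\<^sub>L (real^'m^'d)) \<Rightarrow> real^'d \<Rightarrow> real^'m^'m
      \<Rightarrow> real^'d" where
  "second_order g Dg y A =
     (\<Sum>i\<in>UNIV. \<Sum>j\<in>UNIV. A $ i $ j *\<^sub>R (blinfun_apply (Dg y) (g y *v axis i 1) *v axis j 1))"

(* y k stands for the value at time ts k. *)
definition tamed_solution ::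
    "(real^'d \<Rightarrow> real^'d) \<Rightarrow> (real^'d \<Rightarrow> real^'m^'d) \<Rightarrow> (real^'d \<Rightarrow> (real^'d) \<Rightarrow>\<^sub>L (real^'m^'d)) \<Rightarrow>
     real \<Rightarrow> (nat \<Rightarrow> real) \<Rightarrow> (real \<Rightarrow> real^'m) \<Rightarrow> (real \<Rightarrow> real \<Rightarrow> real^'m^'m) \<Rightarrow>
     real^'d \<Rightarrow> (nat \<Rightarrow> real^'d) \<Rightarrow> bool" where
  "tamed_solution f g Dg M ts x X y\<^sub>0 y \<longleftrightarrow>
     y 0 = y\<^sub>0 \<and>
     (\<forall>k. y (Suc k) =
        y k
        + ((ts (Suc k) - ts k) / (1 + M * norm (f (y k)) * (ts (Suc k) - ts k))) *\<^sub>R f (y k)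
        + g (y k) *v incr x (ts k) (ts (Suc k))
        + second_order g Dg (y k) (X (ts k) (ts (Suc k))))"

(* H over the grid points in [0, ts K], with threshold lam / (C\<^sub>p * C\<^sub>g). *)
definition H_bound ::
    "real \<Rightarrow> real \<Rightarrow> real \<Rightarrow> real \<Rightarrow> real \<Rightarrow> (real \<Rightarrow> real^'m) \<Rightarrow> (real \<Rightarrow> real \<Rightarrow> real^'m^'m) \<Rightarrow>
     (nat \<Rightarrow> real) \<Rightarrow> nat \<Rightarrow> real" where
  "H_bound p C\<^sub>p L_V lam C\<^sub>g x X ts K =
     L_V * (4 * lam + C\<^sub>g * max_jump p x X ts 0 (ts K) + C\<^sub>g\<^sup>2 * (max_jump p x X ts 0 (ts K))\<^sup>2)
       * real (stop_count p x X ts K (lam / (C\<^sub>p * C\<^sub>g)))"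

end

theory Submission
  imports Defs
begin

text \<open>
  Between two stopping times the driftless scheme generates a flow \<open>\<Phi>\<close>. By a discrete sewing argument
  \<open>\<Phi>\<close> is a perturbation of the identity that is bounded by \<open>4\<lambda>\<close> and \<open>\<lambda>\<close>-Lipschitz, once the rough path
  has variation at most \<open>\<lambda>/(C\<^sub>p C\<^sub>g)\<close> there. Hence \<open>\<Phi>\<close> is bijective and \<open>y = \<Phi>(z)\<close> defines a path \<open>z\<close> that moves
  only by the drift, with increments \<open>(I + \<psi>) h f(z + \<eta>)\<close> for small \<open>\<psi>\<close> and \<open>\<eta>\<close>; the Lyapunov condition and
  Gronwall's inequality along each increment give exponential growth of \<open>V(z)\<close>. Returning from \<open>z\<close> to \<open>y\<close>
  costs \<open>4\<lambda>L\<^sub>V\<close> per stopping time, while a single step with a large jump costs at most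
  \<open>L\<^sub>V (C\<^sub>g D + C\<^sub>g\<^sup>2 D\<^sup>2)\<close>, where \<open>D\<close> is the largest jump.
\<close>

subsection \<open>Flows generated by almost flows\<close>

text \<open>The condition p < 3 makes the sewing work. Composing two second-order expansions leaves
  a defect of order \<open>A k l\<close>, later the cube of c R, where the p-th power of R is a
  superadditive control. Halving the control multiplies \<open>A\<close> by \<rho> = (1/2) powr
  (3/p), so two halves cost 2 \<rho> < 1. The gain s = 1 - 2 \<rho> absorbs the remaining terms and
  is the origin of 4 D / s, 8 D / s and the final constant 12 / s. The obstacle is that a control on
  a grid jumps: there may be no halving point, and one grid step may carry nearly all the variation.
  That step can be cut out because flow and expansion agree on it. Smallness of the flow minus the
  identity would not suffice: the Lyapunov condition tolerates the error in the drift direction only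
  relative to the drift itself, and it is the Lipschitz constant that makes the error relative. So
  the sewing is run again on differences, which is where second differences of \<open>r\<close>, and
  through them the third derivative of g, enter.\<close>

locale almost_flow =
  fixes r :: "nat \<Rightarrow> nat \<Rightarrow> 'a::real_normed_vector \<Rightarrow> 'a"
    and A :: "nat \<Rightarrow> nat \<Rightarrow> real"
    and a b :: nat and \<eta> \<rho> s D :: real
  assumes A_nonneg: "\<And>k l. 0 \<le> A k l"
    and A_mono: "\<And>k' k l l'. \<lbrakk>a \<le> k'; k' \<le> k; k \<le> l; l \<le> l'; l' \<le> b\<rbrakk> \<Longrightarrow> A k l \<le> A k' l'"
    and A_split: "\<And>k l. \<lbrakk>a \<le> k; k < l; l \<le> b\<rbrakk> \<Longrightarrow>
      \<exists>u. k \<le> u \<and> u < l \<and> A k u \<le> \<rho> * A k l \<and> A (Suc u) l \<le> \<rho> * A k l"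
    and r_diag: "\<And>k y. r k k y = 0"
    and r_lip: "\<And>k l y y'. \<lbrakk>a \<le> k; k \<le> l; l \<le> b\<rbrakk> \<Longrightarrow>
      norm (r k l y - r k l y') \<le> \<eta> * norm (y - y')"
    and r_diff: "\<And>k l y y' h. \<lbrakk>a \<le> k; k \<le> l; l \<le> b\<rbrakk> \<Longrightarrow>
      norm (r k l (y + h) - r k l y - (r k l (y' + h) - r k l y')) \<le> \<eta> * norm h * norm (y - y')"
    and defect_bound: "\<And>k u l y. \<lbrakk>a \<le> k; k \<le> u; u \<le> l; l \<le> b\<rbrakk> \<Longrightarrow>
      norm (r k u y + r u l (y + r k u y) - r k l y) \<le> D * A k l"
    and defect_lip: "\<And>k u l y y'. \<lbrakk>a \<le> k; k \<le> u; u \<le> l; l \<le> b\<rbrakk> \<Longrightarrow>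
      norm ((r k u y + r u l (y + r k u y) - r k l y)
          - (r k u y' + r u l (y' + r k u y') - r k l y')) \<le> D * A k l * norm (y - y')"
    and D_pos: "0 < D" and eta_nonneg: "0 \<le> \<eta>" and rho_eq: "\<rho> = (1 - s) / 2"
    and s_pos: "0 < s" and s_le: "s \<le> 1" and eta_s: "\<eta> \<le> s / 6"
    and A_small: "8 * D / s * A a b \<le> \<eta>"
begin

definition flow :: "nat \<Rightarrow> nat \<Rightarrow> 'a \<Rightarrow> 'a" where
  "flow k l = fold (\<lambda>j y. y + r j (Suc j) y) [k..<l]"

text \<open>Error of the expansion \<open>r\<close> against the exact discrete flow. It vanishes on
  intervals of at most one step, which is what allows a step to be cut out in the induction.\<close>

definition J :: "nat \<Rightarrow> nat \<Rightarrow> 'a \<Rightarrow> 'a" where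
  "J k l y = flow k l y - y - r k l y"

lemma flow_same: "flow k k y = y"
  by (simp add: flow_def)

lemma flow_Suc: "k \<le> l \<Longrightarrow> flow k (Suc l) y = flow k l y + r l (Suc l) (flow k l y)"
  by (simp add: flow_def)

lemma flow_trans:
  assumes "k \<le> u" "u \<le> l"
  shows "flow k l y = flow u l (flow k u y)"
proof -
  have "[k..<l] = [k..<u] @ [u..<l]"
    using upt_add_eq_append[of k u "l - u"] assms by simp
  then show ?thesis by (simp add: flow_def)
qed

lemma J_same: "J k k y = 0"
  by (simp add: J_def flow_same r_diag)

lemma J_Suc: "J k (Suc k) y = 0"
  by (simp add: J_def flow_Suc flow_same)

text \<open>The flow up to \<open>u\<close> is y + r k u y + J k u y. The four groups are the later
  error at the flowed point, the reaction of \<open>r u l\<close> to the earlier error, the earlier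
  error itself, and the defect of the expansion.\<close>

lemma J_split:
  assumes "k \<le> u" "u \<le> l"
  shows "J k l y = J u l (flow k u y)
      + (r u l (y + r k u y + J k u y) - r u l (y + r k u y)) + J k u y
      + (r k u y + r u l (y + r k u y) - r k l y)"
  using flow_trans[OF assms] by (simp add: J_def)

lemma J_split_bound:
  assumes "a \<le> k" "k \<le> u" "u \<le> l" "l \<le> b"
    and "\<And>y. norm (J k u y) \<le> B1" "\<And>y. norm (J u l y) \<le> B2"
  shows "norm (J k l y) \<le> B2 + (1 + \<eta>) * B1 + D * A k l"
proof -
  have "norm (r u l (y + r k u y + J k u y) - r u l (y + r k u y)) \<le> \<eta> * norm (J k u y)"
    using r_lip[of u l "y + r k u y + J k u y" "y + r k u y"] assms by simp
  also have "\<dots> \<le> \<eta> * B1" using assms(5) eta_nonneg by (intro mult_left_mono) auto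
  finally have 1: "norm (r u l (y + r k u y + J k u y) - r u l (y + r k u y)) \<le> \<eta> * B1" .
  have 2: "norm (r k u y + r u l (y + r k u y) - r k l y) \<le> D * A k l"
    using defect_bound assms by blast
  show ?thesis
    unfolding J_split[OF assms(2,3), of y]
    by (rule order_trans[OF norm_triangle_mono[OF norm_triangle_mono[OF norm_triangle_mono[OF
        assms(6) 1] assms(5)] 2]]) (simp add: algebra_simps)
qed

lemma rho_nonneg: "0 \<le> \<rho>" and rho_less: "\<rho> < 1/2"
  using s_pos s_le rho_eq by auto

text \<open>Davie's argument: splitting \<open>{k..l}\<close> into \<open>{k..u}\<close>, \<open>{u..Suc u}\<close> and \<open>{Suc u..l}\<close>, the middle part
  contributes nothing and the outer two at most a fraction \<open>2\<rho> < 1\<close> of the bound.\<close>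

lemma J_bound:
  assumes "a \<le> k" "k \<le> l" "l \<le> b"
  shows "norm (J k l y) \<le> 4 * D / s * A k l"
  using assms
proof (induction "l - k" arbitrary: k l y rule: less_induct)
  case less
  show ?case
  proof (cases "k = l")
    case True
    then show ?thesis using A_nonneg[of k l] D_pos s_pos by (simp add: J_same)
  next
    case False
    then obtain u where u: "k \<le> u" "u < l" "A k u \<le> \<rho> * A k l" "A (Suc u) l \<le> \<rho> * A k l"
      using A_split[of k l] less.prems by auto
    have lt: "u - k < l - k" "l - Suc u < l - k" using u by auto
    define C where "C = 4 * D / s"
    have C: "0 \<le> C" "C * s = 4 * D" using D_pos s_pos by (auto simp: C_def)
    have 1: "norm (J k u y) \<le> C * (\<rho> * A k l)" for y
      using less.hyps[OF lt(1), of y] less.prems u mult_left_mono[OF u(3) C(1)] by (force simp: C_def)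
    \<comment> \<open>The induction hypothesis is uniform in the base point, as needed for errors
      evaluated along the flow.\<close>
    have 2: "norm (J (Suc u) l y) \<le> C * (\<rho> * A k l)" for y
      using less.hyps[OF lt(2), of y] less.prems u mult_left_mono[OF u(4) C(1)] by (force simp: C_def)
    have 3: "norm (J u l y) \<le> C * (\<rho> * A k l) + D * A k l" for y
    proof -
      have "norm (J u l y) \<le> C * (\<rho> * A k l) + (1 + \<eta>) * 0 + D * A u l"
        using less.prems u 2 by (intro J_split_bound[where u = "Suc u"]) (auto simp: J_Suc)
      moreover have "D * A u l \<le> D * A k l"
        using less.prems u D_pos by (intro mult_left_mono A_mono) auto
      ultimately show ?thesis by simp
    qed
    have "norm (J k l y) \<le> (C * (\<rho> * A k l) + D * A k l) + (1 + \<eta>) * (C * (\<rho> * A k l)) + D * A k l"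
      using less.prems u 1 3 by (intro J_split_bound[where u = u]) auto
    also have "\<dots> = ((2 + \<eta>) * (C * \<rho>) + 2 * D) * A k l" by (simp add: algebra_simps)
    \<comment> \<open>Since 2 C \<rho> = C - 4 D, a margin 4 D is left for the two defects 2 D and
      for \<eta> C \<rho> <= D / 3.\<close>
    also have "\<dots> \<le> C * A k l"
    proof (intro mult_right_mono A_nonneg)
      have "\<eta> * (C * \<rho>) \<le> s / 6 * (C * (1/2))"
        using eta_s eta_nonneg rho_nonneg rho_less s_pos C by (intro mult_mono) auto
      then show "(2 + \<eta>) * (C * \<rho>) + 2 * D \<le> C"
        using C(2) D_pos by (simp add: rho_eq field_simps)
    qed
    finally show ?thesis by (simp add: C_def)
  qed
qed

lemma r_diff2:
  assumes "a \<le> k" "k \<le> l" "l \<le> b"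
  shows "norm (r k l (y + h) - r k l y - (r k l (y' + h') - r k l y'))
    \<le> \<eta> * norm h * norm (y - y') + \<eta> * norm (h - h')"
proof -
  have 1: "norm (r k l (y' + h) - r k l (y' + h')) \<le> \<eta> * norm (h - h')"
    using r_lip[OF assms, of "y' + h" "y' + h'"] by simp
  have "r k l (y + h) - r k l y - (r k l (y' + h') - r k l y')
      = (r k l (y + h) - r k l y - (r k l (y' + h) - r k l y')) + (r k l (y' + h) - r k l (y' + h'))"
    by simp
  then show ?thesis
    using norm_triangle_mono[OF r_diff[OF assms] 1] by metis
qed

lemma flow_lip:
  assumes "a \<le> k" "k \<le> l" "l \<le> b" "norm (J k l y - J k l y') \<le> L * norm (y - y')"
  shows "norm (flow k l y - flow k l y') \<le> (1 + \<eta> + L) * norm (y - y')"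
proof -
  have "flow k l y - flow k l y' = (y - y') + (r k l y - r k l y') + (J k l y - J k l y')"
    by (simp add: J_def)
  then have "norm (flow k l y - flow k l y') \<le> norm (y - y') + \<eta> * norm (y - y') + L * norm (y - y')"
    using norm_triangle_mono[OF norm_triangle_mono[OF order_refl r_lip[OF assms(1-3)]] assms(4), of "y - y'"]
    by metis
  then show ?thesis by (simp add: algebra_simps)
qed

text \<open>The terms of \<open>J_split\<close> are compared at two base points. In the reaction
  term both base point and increment change, so second differences of \<open>r\<close> and the size
  \<open>B1\<close> of the earlier error enter; the later error brings in the Lipschitz constant of
  the flow.\<close>

lemma J_split_lip:
  assumes "a \<le> k" "k \<le> u" "u \<le> l" "l \<le> b" "0 \<le> L2"
    and B1: "\<And>y. norm (J k u y) \<le> B1"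
    and L1: "\<And>y y'. norm (J k u y - J k u y') \<le> L1 * norm (y - y')"
    and L2: "\<And>y y'. norm (J u l y - J u l y') \<le> L2 * norm (y - y')"
  shows "norm (J k l y - J k l y')
    \<le> (L2 * (1 + \<eta> + L1) + \<eta> * B1 * (1 + \<eta>) + (1 + \<eta>) * L1 + D * A k l) * norm (y - y')"
proof -
  define n where "n = norm (y - y')"
  have B0: "0 \<le> B1" using B1[of 0] norm_ge_zero order_trans by blast
  define q q' where "q = y + r k u y" "q' = y' + r k u y'"
  have q: "norm (q - q') \<le> (1 + \<eta>) * n"
  proof -
    have "q - q' = (y - y') + (r k u y - r k u y')" by (simp add: q_q'_def)
    then have "norm (q - q') \<le> norm (y - y') + \<eta> * norm (y - y')"
      using norm_triangle_mono[OF order_refl r_lip, of k u "y - y'" y y'] assms by simp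
    then show ?thesis by (simp add: n_def algebra_simps)
  qed
  have 1: "norm (J u l (flow k u y) - J u l (flow k u y')) \<le> L2 * ((1 + \<eta> + L1) * n)"
    unfolding n_def
    by (rule order_trans[OF L2]) (use assms flow_lip[of k u y y' L1] in \<open>auto intro!: mult_left_mono\<close>)
  have "norm (r u l (q + J k u y) - r u l q - (r u l (q' + J k u y') - r u l q'))
    \<le> \<eta> * norm (J k u y) * norm (q - q') + \<eta> * norm (J k u y - J k u y')"
    using assms by (intro r_diff2) auto
  also have "\<dots> \<le> \<eta> * B1 * ((1 + \<eta>) * n) + \<eta> * (L1 * n)"
    unfolding n_def using q B1 L1 eta_nonneg B0
    by (intro add_mono mult_mono mult_left_mono) (auto simp: n_def)
  finally have 2: "norm (r u l (q + J k u y) - r u l q - (r u l (q' + J k u y') - r u l q'))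
    \<le> \<eta> * B1 * ((1 + \<eta>) * n) + \<eta> * (L1 * n)" .
  have 3: "norm (J k u y - J k u y') \<le> L1 * n" using L1 by (simp add: n_def)
  have 4: "norm ((r k u y + r u l (y + r k u y) - r k l y)
          - (r k u y' + r u l (y' + r k u y') - r k l y')) \<le> D * A k l * n"
    using defect_lip[of k u l y y'] assms by (simp add: n_def)
  have "J k l y - J k l y' = (J u l (flow k u y) - J u l (flow k u y'))
     + (r u l (q + J k u y) - r u l q - (r u l (q' + J k u y') - r u l q'))
     + (J k u y - J k u y')
     + ((r k u y + r u l (y + r k u y) - r k l y) - (r k u y' + r u l (y' + r k u y') - r k l y'))"
    unfolding J_split[OF assms(2,3), of y] J_split[OF assms(2,3), of y']
    by (simp add: q_q'_def algebra_simps)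
  then have "norm (J k l y - J k l y')
     \<le> L2 * ((1 + \<eta> + L1) * n) + (\<eta> * B1 * ((1 + \<eta>) * n) + \<eta> * (L1 * n)) + L1 * n + D * A k l * n"
    using norm_triangle_mono[OF norm_triangle_mono[OF norm_triangle_mono[OF 1 2] 3] 4] by metis
  then show ?thesis by (simp add: n_def algebra_simps)
qed

text \<open>The induction of \<open>J_bound\<close> again, but composing errors multiplies Lipschitz
  constants and makes the recursion quadratic. \<open>A_small\<close> caps one factor by \<eta>,
  which makes it linear again; the larger constant 8 D / s pays for the extra terms.\<close>

lemma J_lip:
  assumes "a \<le> k" "k \<le> l" "l \<le> b"
  shows "norm (J k l y - J k l y') \<le> 8 * D / s * A k l * norm (y - y')"
  using assms
proof (induction "l - k" arbitrary: k l y y' rule: less_induct)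
  case less
  show ?case
  proof (cases "k = l")
    case True
    then show ?thesis using A_nonneg[of k l] D_pos s_pos by (simp add: J_same)
  next
    case False
    then obtain u where u: "k \<le> u" "u < l" "A k u \<le> \<rho> * A k l" "A (Suc u) l \<le> \<rho> * A k l"
      using A_split[of k l] less.prems by auto
    have lt: "u - k < l - k" "l - Suc u < l - k" using u by auto
    define C where "C = 8 * D / s"
    define w where "w = A k l"
    have w0: "0 \<le> w" using A_nonneg by (simp add: w_def)
    have C: "0 \<le> C" "C * s = 8 * D" using D_pos s_pos by (auto simp: C_def)
    have Csmall: "C * A k u \<le> \<eta>"
    proof -
      have "C * A k u \<le> C * A a b" using C less.prems u by (intro mult_left_mono A_mono) auto
      then show ?thesis using A_small by (simp add: C_def)
    qed
    have 1: "norm (J k u y - J k u y') \<le> min (C * (\<rho> * w)) \<eta> * norm (y - y')" for y y'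
    proof -
      have "norm (J k u y - J k u y') \<le> C * A k u * norm (y - y')"
        using less.hyps[OF lt(1), of y y'] less.prems u by (simp add: C_def)
      also have "\<dots> \<le> min (C * (\<rho> * w)) \<eta> * norm (y - y')"
        using Csmall mult_left_mono[OF u(3) C(1)] by (intro mult_right_mono) (auto simp: w_def)
      finally show ?thesis .
    qed
    have 2: "norm (J (Suc u) l y - J (Suc u) l y') \<le> C * (\<rho> * w) * norm (y - y')" for y y'
    proof -
      have "norm (J (Suc u) l y - J (Suc u) l y') \<le> C * A (Suc u) l * norm (y - y')"
        using less.hyps[OF lt(2), of y y'] less.prems u by (simp add: C_def)
      also have "\<dots> \<le> C * (\<rho> * w) * norm (y - y')"
        using mult_left_mono[OF u(4) C(1)] by (intro mult_right_mono) (auto simp: w_def)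
      finally show ?thesis .
    qed
    have 3: "norm (J u l y - J u l y') \<le> (C * (\<rho> * w) * (1 + \<eta>) + D * w) * norm (y - y')" for y y'
    proof -
      have "norm (J u l y - J u l y')
        \<le> (C * (\<rho> * w) * (1 + \<eta> + 0) + \<eta> * 0 * (1 + \<eta>) + (1 + \<eta>) * 0 + D * A u l) * norm (y - y')"
        using less.prems u 2 C w0 rho_nonneg by (intro J_split_lip[where u = "Suc u"]) (auto simp: J_Suc)
      also have "\<dots> \<le> (C * (\<rho> * w) * (1 + \<eta>) + D * w) * norm (y - y')"
        using less.prems u D_pos by (intro mult_right_mono) (auto simp: w_def intro: A_mono)
      finally show ?thesis .
    qed
    have B1: "norm (J k u y) \<le> 4 * D / s * w" for y
    proof -
      have "norm (J k u y) \<le> 4 * D / s * A k u"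
        using J_bound less.prems u by simp
      also have "\<dots> \<le> 4 * D / s * w"
        using less.prems u D_pos s_pos unfolding w_def by (intro mult_left_mono A_mono) auto
      finally show ?thesis .
    qed
    define m where "m = min (C * (\<rho> * w)) \<eta>"
    define K where "K = C * (\<rho> * w) * (1 + \<eta>) + D * w"
    have K0: "0 \<le> K" using C w0 rho_nonneg eta_nonneg D_pos by (simp add: K_def)
    have "norm (J k l y - J k l y')
        \<le> (K * (1 + \<eta> + m) + \<eta> * (4 * D / s * w) * (1 + \<eta>) + (1 + \<eta>) * m + D * A k l) * norm (y - y')"
      using less.prems u 1 3 B1 K0 by (intro J_split_lip[where u = u]) (auto simp: m_def K_def)
    also have "\<dots> \<le> C * w * norm (y - y')"
    proof (intro mult_right_mono)
      have e: "\<eta> \<le> 1/6" using eta_s s_le by simp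
      have "K * (1 + \<eta> + m) + \<eta> * (4 * D / s * w) * (1 + \<eta>) + (1 + \<eta>) * m + D * A k l
         \<le> K * (1 + \<eta> + \<eta>) + (s/6) * (4 * D / s * w) * (1 + 1/6) + (1 + \<eta>) * (C * (\<rho> * w)) + D * w"
        using K0 eta_nonneg eta_s e w0 D_pos s_pos
        by (intro add_mono mult_left_mono mult_right_mono mult_mono) (auto simp: m_def w_def)
      also have "\<dots> = K * (1 + \<eta> + \<eta>) + (7/9) * (D * w) + (1 + \<eta>) * (C * (\<rho> * w)) + D * w"
        using s_pos by (simp add: field_simps)
      also have "\<dots> = (2 * ((1 + \<eta>)\<^sup>2 * (C * \<rho>)) + D * (1 + 2 * \<eta>) + 16/9 * D) * w"
        by (simp add: K_def power2_eq_square algebra_simps)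
      \<comment> \<open>Now 2 C \<rho> = C - 8 D, and the margin 8 D covers 26/9 D + 4/3 D + 16/9 D
        = 6 D.\<close>
      also have "\<dots> \<le> C * w"
      proof (intro mult_right_mono w0)
        have "\<eta> * \<eta> \<le> \<eta> * (1/6)" using e eta_nonneg by (intro mult_left_mono) auto
        then have "(1 + \<eta>)\<^sup>2 \<le> 1 + 13/6 * \<eta>" by (simp add: power2_eq_square algebra_simps)
        also have "\<dots> \<le> 1 + 13/36 * s" using eta_s by simp
        finally have "(1 + \<eta>)\<^sup>2 * (C * \<rho>) \<le> (1 + 13/36 * s) * (C * \<rho>)"
          using C rho_nonneg by (intro mult_right_mono) auto
        also have "\<dots> = C * \<rho> + 13/36 * (s * C) * \<rho>" by (simp add: algebra_simps)
        also have "\<dots> \<le> C * \<rho> + 13/36 * (s * C) * (1/2)"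
          using rho_less C s_pos by (intro add_left_mono mult_left_mono) auto
        finally have "(1 + \<eta>)\<^sup>2 * (C * \<rho>) \<le> C * \<rho> + 13/36 * (8 * D) * (1/2)"
          using C(2) by (simp add: mult.commute)
        moreover have "C * \<rho> = (C - 8 * D) / 2"
          unfolding rho_eq C(2)[symmetric] by (simp add: right_diff_distrib)
        moreover have "D * (1 + 2 * \<eta>) \<le> D * (4/3)" using e D_pos by (intro mult_left_mono) auto
        moreover have "2 * P + Q + 16/9 * D \<le> C"
          if "P \<le> R + 13/36 * (8 * D) * (1/2)" "R = (C - 8 * D) / 2" "Q \<le> D * (4/3)" for P Q R
          using that D_pos by argo
        ultimately show "2 * ((1 + \<eta>)\<^sup>2 * (C * \<rho>)) + D * (1 + 2 * \<eta>) + 16/9 * D \<le> C"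
          by blast
      qed
      finally show "K * (1 + \<eta> + m) + \<eta> * (4 * D / s * w) * (1 + \<eta>) + (1 + \<eta>) * m + D * A k l \<le> C * w" .
    qed simp
    finally show ?thesis by (simp add: C_def w_def)
  qed
qed

text \<open>The expansion and its error contribute \<eta> each, the latter by
  \<open>A_small\<close>.\<close>

lemma flow_minus_id_lip:
  assumes "a \<le> k" "k \<le> l" "l \<le> b"
  shows "norm ((flow k l y - y) - (flow k l y' - y')) \<le> 2 * \<eta> * norm (y - y')"
proof -
  have "8 * D / s * A k l \<le> 8 * D / s * A a b"
    using assms D_pos s_pos by (intro mult_left_mono A_mono) auto
  also have "\<dots> \<le> \<eta>" using A_small by simp
  finally have "norm (J k l y - J k l y') \<le> \<eta> * norm (y - y')"
    using J_lip[OF assms, of y y'] by (meson mult_right_mono norm_ge_zero order_trans)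
  from norm_triangle_mono[OF r_lip[OF assms, of y y'] this]
  show ?thesis by (simp add: J_def algebra_simps)
qed

lemma flow_minus_id_bound:
  assumes "a \<le> k" "k \<le> l" "l \<le> b"
  shows "norm (flow k l y - y) \<le> norm (r k l y) + \<eta>"
proof -
  have "4 * D / s * A k l \<le> 8 * D / s * A a b"
    using assms D_pos s_pos by (intro mult_mono A_mono divide_right_mono) (auto simp: A_nonneg)
  also have "\<dots> \<le> \<eta>" using A_small by simp
  finally have "norm (J k l y) \<le> \<eta>" using J_bound[OF assms, of y] by simp
  from norm_triangle_mono[OF order_refl this, of "r k l y"] show ?thesis by (simp add: J_def)
qed

end

subsection \<open>Taylor estimates and matrix norms\<close>

lemma lipschitz_of_derivative:
  fixes f :: "'a::real_normed_vector \<Rightarrow> 'b::real_normed_vector"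
  assumes "convex S" "\<And>z. z \<in> S \<Longrightarrow> (f has_derivative f' z) (at z)"
    and "\<And>z v. z \<in> S \<Longrightarrow> norm (f' z v) \<le> K * norm v" and "0 \<le> K" "y \<in> S" "y' \<in> S"
  shows "norm (f y - f y') \<le> K * norm (y - y')"
  using assms by (intro differentiable_bound[where S = S and f' = f'] onorm_bound)
    (auto intro: has_derivative_at_withinI)

lemma has_derivative_shift:
  assumes "\<And>z. (f has_derivative f' z) (at z)"
  shows "((\<lambda>y. f (y + h)) has_derivative f' (y + h)) (at y)"
    and "((\<lambda>y. f (h + y)) has_derivative f' (h + y)) (at y)"
proof -
  have "((\<lambda>y. y + h) has_derivative (\<lambda>v. v)) (at y)" "((\<lambda>y. h + y) has_derivative (\<lambda>v. v)) (at y)"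
    by (auto intro!: derivative_eq_intros)
  from this[THEN has_derivative_compose, OF assms]
  show "((\<lambda>y. f (y + h)) has_derivative f' (y + h)) (at y)"
    "((\<lambda>y. f (h + y)) has_derivative f' (h + y)) (at y)" by simp_all
qed

text \<open>Mean value inequality for y -> f (y + h) - f y, whose derivative is small because f' is
  Lipschitz.\<close>

lemma second_difference:
  fixes f :: "'a::real_normed_vector \<Rightarrow> 'b::real_normed_vector"
  assumes "\<And>z. (f has_derivative f' z) (at z)"
    and "\<And>z z' v. norm (f' z v - f' z' v) \<le> K * norm (z - z') * norm v" and "0 \<le> K"
  shows "norm (f (y + h) - f y - (f (y' + h) - f y')) \<le> K * norm h * norm (y - y')"
proof (rule lipschitz_of_derivative[where S = UNIV and f' = "\<lambda>y v. f' (y + h) v - f' y v"])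
  show "norm (f' (z + h) v - f' z v) \<le> K * norm h * norm v" for z v
    using assms(2)[of "z + h" v z] by simp
qed (use assms in \<open>auto intro!: has_derivative_diff has_derivative_shift\<close>)

text \<open>As a function of h the Taylor remainder has derivative f' (y + h) - f' y, of size at
  most K m on the ball of radius m.\<close>

lemma taylor_lip_increment:
  fixes f :: "'a::real_normed_vector \<Rightarrow> 'b::real_normed_vector"
  assumes df: "\<And>z. (f has_derivative f' z) (at z)"
    and "\<And>z z' v. norm (f' z v - f' z' v) \<le> K * norm (z - z') * norm v" and "0 \<le> K"
    and "norm h \<le> m" "norm h' \<le> m"
  shows "norm (f (y + h) - f y - f' y h - (f (y + h') - f y - f' y h')) \<le> K * m * norm (h - h')"
proof (rule lipschitz_of_derivative[where S = "cball 0 m" and f' = "\<lambda>h v. f' (y + h) v - f' y v"])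
  have m: "0 \<le> m" using assms(4) norm_ge_zero order_trans by blast
  then show "0 \<le> K * m" using assms by simp
  show "norm (f' (y + z) v - f' y v) \<le> K * m * norm v" if "z \<in> cball 0 m" for z v
  proof -
    have "norm (f' (y + z) v - f' y v) \<le> K * norm z * norm v" using assms(2)[of "y + z" v y] by simp
    also have "\<dots> \<le> K * m * norm v"
      using that assms(3) by (intro mult_right_mono mult_left_mono) auto
    finally show ?thesis .
  qed
  have lin: "bounded_linear (f' y)" using df has_derivative_bounded_linear by blast
  show "((\<lambda>h. f (y + h) - f y - f' y h) has_derivative (\<lambda>v. f' (y + z) v - f' y v)) (at z)" for z
    using has_derivative_diff[OF has_derivative_diff[OF has_derivative_shift(2)[OF df] has_derivative_const]
        bounded_linear_imp_has_derivative[OF lin]] by simp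
qed (use assms in auto)

text \<open>Working along \<open>s \<mapsto> y + s h\<close> avoids the symmetry of the second derivative, which
  differentiation in \<open>y\<close> would require.\<close>

lemma taylor_lip_base:
  fixes f :: "'a::real_normed_vector \<Rightarrow> 'b::real_normed_vector"
  assumes df: "\<And>z. (f has_derivative f' z) (at z)"
    and d2: "\<And>y y' k v. norm (f' (y + k) v - f' y v - (f' (y' + k) v - f' y' v))
      \<le> K * norm k * norm (y - y') * norm v" and "0 \<le> K"
  shows "norm (f (y + h) - f y - f' y h - (f (y' + h) - f y' - f' y' h))
    \<le> K * (norm h)\<^sup>2 * norm (y - y')"
proof -
  have lin: "bounded_linear (f' z)" for z using df has_derivative_bounded_linear by blast
  \<comment> \<open>\<open>R 1 - R 0\<close> is the difference of the two Taylor remainders.\<close>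
  define R where "R s = f (y + s *\<^sub>R h) - s *\<^sub>R f' y h - (f (y' + s *\<^sub>R h) - s *\<^sub>R f' y' h)" for s :: real
  have d: "((\<lambda>s. f (z + s *\<^sub>R h)) has_derivative (\<lambda>\<sigma>. f' (z + s *\<^sub>R h) (\<sigma> *\<^sub>R h))) (at s)" for z s
    by (rule has_derivative_compose[OF _ df]) (auto intro!: derivative_eq_intros)
  have "norm (R 1 - R 0) \<le> (K * (norm h)\<^sup>2 * norm (y - y')) * norm (1 - 0 :: real)"
  proof (rule lipschitz_of_derivative[where S = "{0..1}" and
        f' = "\<lambda>s \<sigma>. f' (y + s *\<^sub>R h) (\<sigma> *\<^sub>R h) - \<sigma> *\<^sub>R f' y h - (f' (y' + s *\<^sub>R h) (\<sigma> *\<^sub>R h) - \<sigma> *\<^sub>R f' y' h)"])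
    show "(R has_derivative (\<lambda>\<sigma>. f' (y + s *\<^sub>R h) (\<sigma> *\<^sub>R h) - \<sigma> *\<^sub>R f' y h
        - (f' (y' + s *\<^sub>R h) (\<sigma> *\<^sub>R h) - \<sigma> *\<^sub>R f' y' h))) (at s)" for s
      unfolding R_def by (intro has_derivative_diff d has_derivative_scaleR_left has_derivative_ident)
    fix s \<sigma> :: real assume s: "s \<in> {0..1}"
    have "f' (y + s *\<^sub>R h) (\<sigma> *\<^sub>R h) - \<sigma> *\<^sub>R f' y h - (f' (y' + s *\<^sub>R h) (\<sigma> *\<^sub>R h) - \<sigma> *\<^sub>R f' y' h)
       = \<sigma> *\<^sub>R (f' (y + s *\<^sub>R h) h - f' y h - (f' (y' + s *\<^sub>R h) h - f' y' h))"
      by (simp add: linear_cmul[OF bounded_linear.linear[OF lin]] algebra_simps)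
    then have "norm (f' (y + s *\<^sub>R h) (\<sigma> *\<^sub>R h) - \<sigma> *\<^sub>R f' y h - (f' (y' + s *\<^sub>R h) (\<sigma> *\<^sub>R h) - \<sigma> *\<^sub>R f' y' h))
       = \<bar>\<sigma>\<bar> * norm (f' (y + s *\<^sub>R h) h - f' y h - (f' (y' + s *\<^sub>R h) h - f' y' h))" by simp
    also have "\<dots> \<le> \<bar>\<sigma>\<bar> * (K * norm (s *\<^sub>R h) * norm (y - y') * norm h)"
      by (intro mult_left_mono d2) auto
    also have "\<dots> \<le> \<bar>\<sigma>\<bar> * (K * norm h * norm (y - y') * norm h)"
      using s assms(3) by (intro mult_left_mono mult_right_mono) (auto simp: mult_left_le_one_le)
    finally show "norm (f' (y + s *\<^sub>R h) (\<sigma> *\<^sub>R h) - \<sigma> *\<^sub>R f' y h - (f' (y' + s *\<^sub>R h) (\<sigma> *\<^sub>R h) - \<sigma> *\<^sub>R f' y' h))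
        \<le> K * (norm h)\<^sup>2 * norm (y - y') * norm \<sigma>"
      by (simp add: power2_eq_square mult_ac)
  qed (use assms in auto)
  then show ?thesis by (simp add: R_def algebra_simps)
qed

text \<open>The shape of \<open>E\<close> uses Chen's relation, which turns the second-order term over the whole interval
  into \<open>b + c + Df(a)\<close>.\<close>

lemma composition_defect:
  fixes a b f :: "'a::real_normed_vector \<Rightarrow> 'a"
  assumes \<alpha>: "0 \<le> \<alpha>" "\<alpha> \<le> 1/2"
    and a0: "\<And>y. norm (a y) \<le> \<alpha>" and a1: "\<And>y y'. norm (a y - a y') \<le> \<alpha> * norm (y - y')"
    and b0: "\<And>y. norm (b y) \<le> \<alpha>\<^sup>2" and b1: "\<And>y y'. norm (b y - b y') \<le> 2 * \<alpha>\<^sup>2 * norm (y - y')"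
    and df: "\<And>z. (f has_derivative f' z) (at z)"
    and f1: "\<And>z v. norm (f' z v) \<le> \<alpha> * norm v"
    and f2: "\<And>z z' v. norm (f' z v - f' z' v) \<le> \<alpha> * norm (z - z') * norm v"
    and f3: "\<And>y y' k v. norm (f' (y + k) v - f' y v - (f' (y' + k) v - f' y' v))
      \<le> \<alpha> * norm k * norm (y - y') * norm v"
    and c1: "\<And>y y'. norm (c y - c y') \<le> 2 * \<alpha>\<^sup>2 * norm (y - y')"
    and c2: "\<And>y y' h. norm (c (y + h) - c y - (c (y' + h) - c y')) \<le> 4 * \<alpha>\<^sup>2 * norm h * norm (y - y')"
    and E: "\<And>y. E y = (a y + b y) + (f (y + (a y + b y)) + c (y + (a y + b y)))
        - (a y + f y + (b y + c y + f' y (a y)))"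
  shows "norm (E y) \<le> 23 * \<alpha>^3" "norm (E y - E y') \<le> 23 * \<alpha>^3 * norm (y - y')"
proof -
  define h where "h y = a y + b y" for y
  define n where "n = norm (y - y')"
  have n0: "0 \<le> n" by (simp add: n_def)
  have lin: "bounded_linear (f' z)" for z using df has_derivative_bounded_linear by blast
  have \<alpha>2: "2 * \<alpha>\<^sup>2 \<le> \<alpha>" using mult_left_mono[OF \<alpha>(2,1)] by (simp add: power2_eq_square)
  have h0: "norm (h y) \<le> 2 * \<alpha>" for y
    using norm_triangle_mono[OF a0 b0, of y y] \<alpha>2 \<alpha> by (simp add: h_def)
  have h1: "norm (h y - h y') \<le> 2 * \<alpha> * n"
  proof -
    have "h y - h y' = (a y - a y') + (b y - b y')" by (simp add: h_def)
    then have "norm (h y - h y') \<le> \<alpha> * n + 2 * \<alpha>\<^sup>2 * n"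
      using norm_triangle_mono[OF a1 b1, of y y' y y'] by (simp add: n_def)
    also have "\<dots> \<le> \<alpha> * n + \<alpha> * n" using \<alpha>2 n0 by (intro add_left_mono mult_right_mono) auto
    finally show ?thesis by simp
  qed
  \<comment> \<open>The leading terms cancel. What remains is a Taylor remainder of f, f' applied to
    b, and an increment of c, each of order \<alpha>^3.\<close>
  have E': "E y = (f (y + h y) - f y - f' y (h y)) + f' y (b y) + (c (y + h y) - c y)" for y
    by (simp add: E h_def linear_add[OF bounded_linear.linear[OF lin]])
  have 1: "norm (f (y + h y) - f y - f' y (h y)) \<le> 4 * \<alpha>^3"
  proof -
    have "norm (f (y + h y) - f y - f' y (h y)) \<le> \<alpha> * (2 * \<alpha>) * norm (h y)"
      using taylor_lip_increment[OF df f2, of "h y" "2 * \<alpha>" 0 y] h0 \<alpha>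
      by (simp add: linear_0[OF bounded_linear.linear[OF lin]])
    also have "\<dots> \<le> \<alpha> * (2 * \<alpha>) * (2 * \<alpha>)" using h0 \<alpha> by (intro mult_left_mono) auto
    finally show ?thesis by (simp add: power3_eq_cube)
  qed
  have 2: "norm (f' y (b y)) \<le> \<alpha>^3"
    using order_trans[OF f1 mult_left_mono[OF b0 \<alpha>(1)]]
    by (simp add: power3_eq_cube power2_eq_square mult_ac)
  have 3: "norm (c (y + h y) - c y) \<le> 4 * \<alpha>^3"
  proof -
    have "norm (c (y + h y) - c y) \<le> 2 * \<alpha>\<^sup>2 * norm (h y)" using c1[of "y + h y" y] by simp
    also have "\<dots> \<le> 2 * \<alpha>\<^sup>2 * (2 * \<alpha>)" using h0 \<alpha> by (intro mult_left_mono) auto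
    finally show ?thesis by (simp add: power3_eq_cube power2_eq_square)
  qed
  have "norm (E y) \<le> 4 * \<alpha>^3 + \<alpha>^3 + 4 * \<alpha>^3"
    unfolding E' by (intro norm_triangle_mono 1 2 3)
  also have "\<dots> \<le> 23 * \<alpha>^3" using \<alpha> by simp
  finally show "norm (E y) \<le> 23 * \<alpha>^3" .
  define R where "R y h = f (y + h) - f y - f' y h" for y h
  have R1: "norm (R y (h y) - R y' (h y)) \<le> 4 * \<alpha>^3 * n"
  proof -
    have "norm (R y (h y) - R y' (h y)) \<le> \<alpha> * (norm (h y))\<^sup>2 * n"
      using taylor_lip_base[OF df f3 \<alpha>(1)] by (simp add: R_def n_def)
    also have "\<dots> \<le> \<alpha> * (2 * \<alpha>)\<^sup>2 * n"
      using h0 \<alpha> n0 by (intro mult_right_mono mult_left_mono power_mono) auto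
    finally show ?thesis by (simp add: power3_eq_cube power2_eq_square)
  qed
  have R2: "norm (R y' (h y) - R y' (h y')) \<le> 4 * \<alpha>^3 * n"
  proof -
    have "norm (R y' (h y) - R y' (h y')) \<le> \<alpha> * (2 * \<alpha>) * norm (h y - h y')"
      using taylor_lip_increment[OF df f2 \<alpha>(1) h0 h0] by (simp add: R_def)
    also have "\<dots> \<le> \<alpha> * (2 * \<alpha>) * (2 * \<alpha> * n)" using h1 \<alpha> by (intro mult_left_mono) auto
    finally show ?thesis by (simp add: power3_eq_cube)
  qed
  have B1: "norm (f' y (b y) - f' y' (b y)) \<le> \<alpha>^3 * n"
  proof -
    have "norm (f' y (b y) - f' y' (b y)) \<le> \<alpha> * n * norm (b y)" using f2 by (simp add: n_def)
    also have "\<dots> \<le> \<alpha> * n * \<alpha>\<^sup>2" using b0 n0 \<alpha> by (intro mult_left_mono) auto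
    finally show ?thesis by (simp add: power3_eq_cube power2_eq_square mult_ac)
  qed
  have B2: "norm (f' y' (b y - b y')) \<le> 2 * \<alpha>^3 * n"
    using order_trans[OF f1 mult_left_mono[OF b1 \<alpha>(1)], of y' y y']
    by (simp add: power3_eq_cube power2_eq_square n_def mult_ac)
  have C1: "norm (c (y + h y) - c y - (c (y' + h y) - c y')) \<le> 8 * \<alpha>^3 * n"
  proof -
    have "norm (c (y + h y) - c y - (c (y' + h y) - c y')) \<le> 4 * \<alpha>\<^sup>2 * norm (h y) * n"
      using c2 by (simp add: n_def)
    also have "\<dots> \<le> 4 * \<alpha>\<^sup>2 * (2 * \<alpha>) * n" using h0 n0 by (intro mult_right_mono mult_left_mono) auto
    finally show ?thesis by (simp add: power3_eq_cube power2_eq_square)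
  qed
  have C2: "norm (c (y' + h y) - c (y' + h y')) \<le> 4 * \<alpha>^3 * n"
  proof -
    have "norm (c (y' + h y) - c (y' + h y')) \<le> 2 * \<alpha>\<^sup>2 * norm (h y - h y')"
      using c1[of "y' + h y" "y' + h y'"] by simp
    also have "\<dots> \<le> 2 * \<alpha>\<^sup>2 * (2 * \<alpha> * n)" using h1 by (intro mult_left_mono) auto
    finally show ?thesis by (simp add: power3_eq_cube power2_eq_square)
  qed
  \<comment> \<open>Each of the three terms is varied first in the base point with the increment
    frozen, then in the increment. The constant is 4 + 4 + 1 + 2 + 8 + 4 = 23.\<close>
  have "E y - E y' = (R y (h y) - R y' (h y)) + (R y' (h y) - R y' (h y'))
     + (f' y (b y) - f' y' (b y)) + f' y' (b y - b y')
     + (c (y + h y) - c y - (c (y' + h y) - c y')) + (c (y' + h y) - c (y' + h y'))"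
    by (simp add: E' R_def linear_diff[OF bounded_linear.linear[OF lin]])
  also have "norm \<dots> \<le> 4 * \<alpha>^3 * n + 4 * \<alpha>^3 * n + \<alpha>^3 * n + 2 * \<alpha>^3 * n + 8 * \<alpha>^3 * n + 4 * \<alpha>^3 * n"
    by (intro norm_triangle_mono R1 R2 B1 B2 C1 C2)
  finally show "norm (E y - E y') \<le> 23 * \<alpha>^3 * norm (y - y')" by (simp add: n_def mult_ac)
qed

section \<open>Frobenius norms and the second-order term\<close>

lemma norm_matrix_vector_mult:
  fixes A :: "real^'n^'m"
  shows "norm (A *v x) \<le> norm A * norm x"
proof -
  have "norm (A *v x) = L2_set (\<lambda>i. norm ((A *v x) $ i)) UNIV" by (simp add: norm_vec_def)
  also have "\<dots> \<le> L2_set (\<lambda>i. norm (A $ i) * norm x) UNIV"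
    by (intro L2_set_mono) (auto simp: matrix_vector_mul_component intro: Cauchy_Schwarz_ineq2)
  also have "\<dots> = norm A * norm x" by (simp add: norm_vec_def L2_set_left_distrib)
  finally show ?thesis .
qed

text \<open>The Frobenius norm through columns, because \<open>contract\<close> pairs columns of G
  with rows of A.\<close>

lemma norm_matrix_columns:
  fixes A :: "real^'n^'m"
  shows "norm A = L2_set (\<lambda>i. norm (column i A)) UNIV"
proof -
  have "(\<Sum>i\<in>UNIV. \<Sum>j\<in>UNIV. (A $ i $ j)\<^sup>2) = (\<Sum>j\<in>UNIV. \<Sum>i\<in>UNIV. (A $ i $ j)\<^sup>2)"
    by (rule sum.swap)
  then show ?thesis by (simp add: norm_vec_def L2_set_def column_def sum_nonneg)
qed

lemma norm_tensor: "norm (tensor a b) = norm a * norm b"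
proof -
  have "(\<Sum>i\<in>UNIV. \<Sum>j\<in>UNIV. (a $ i * b $ j)\<^sup>2) = (\<Sum>i\<in>UNIV. (a $ i)\<^sup>2) * (\<Sum>j\<in>UNIV. (b $ j)\<^sup>2)"
    by (simp add: power_mult_distrib sum_product)
  then show ?thesis
    by (simp add: norm_vec_def L2_set_def tensor_def sum_nonneg real_sqrt_mult[symmetric])
qed

lemma tensor_mult_vec: "tensor a b *v c = inner b c *\<^sub>R a"
  by (simp add: vec_eq_iff tensor_def matrix_vector_mult_def inner_vec_def sum_distrib_right
      sum_distrib_left mult_ac)

text \<open>The second-order term with g y and Dg y as free arguments. It is bilinear in them, so
  the product rule applies.\<close>

definition contract ::
    "real^'m^'m \<Rightarrow> real^'m^'d \<Rightarrow> ((real^'d) \<Rightarrow>\<^sub>L (real^'m^'d)) \<Rightarrow> real^'d" where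
  "contract A G H = (\<Sum>i\<in>UNIV. \<Sum>j\<in>UNIV. A $ i $ j *\<^sub>R (blinfun_apply H (G *v axis i 1) *v axis j 1))"

lemma second_order_contract: "second_order g Dg y A = contract A (g y) (Dg y)"
  by (simp add: second_order_def contract_def)

lemma matrix_vector_sum_axis:
  fixes M :: "real^'n^'m"
  shows "(\<Sum>j\<in>UNIV. x $ j *\<^sub>R (M *v axis j 1)) = M *v x"
  by (simp add: matrix_vector_mult_basis matrix_mult_sum[of M x] scalar_mult_eq_scaleR)

lemma contract_eq: "contract A G H = (\<Sum>i\<in>UNIV. blinfun_apply H (G *v axis i 1) *v (A $ i))"
  by (simp add: contract_def matrix_vector_sum_axis)

text \<open>Cauchy-Schwarz pairs the column norms of G with the row norms of A, while H acts through
  its operator norm; hence no factor depends on the dimension.\<close>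

lemma norm_contract: "norm (contract A G H) \<le> norm A * norm G * norm H"
proof -
  have "norm (contract A G H) \<le> (\<Sum>i\<in>UNIV. norm H * (\<bar>norm (column i G)\<bar> * \<bar>norm (A $ i)\<bar>))"
    unfolding contract_eq
  proof (rule sum_norm_le)
    fix i
    have "norm (blinfun_apply H (G *v axis i 1) *v (A $ i))
        \<le> norm (blinfun_apply H (G *v axis i 1)) * norm (A $ i)"
      by (rule norm_matrix_vector_mult)
    also have "\<dots> \<le> norm H * norm (column i G) * norm (A $ i)"
      using norm_blinfun[of H "column i G"] by (intro mult_right_mono) (auto simp: matrix_vector_mult_basis)
    finally show "norm (blinfun_apply H (G *v axis i 1) *v (A $ i))
        \<le> norm H * (\<bar>norm (column i G)\<bar> * \<bar>norm (A $ i)\<bar>)" by (simp add: mult_ac)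
  qed
  also have "\<dots> = norm H * (\<Sum>i\<in>UNIV. \<bar>norm (column i G)\<bar> * \<bar>norm (A $ i)\<bar>)"
    by (simp add: sum_distrib_left)
  also have "\<dots> \<le> norm H * (L2_set (\<lambda>i. norm (column i G)) UNIV * L2_set (\<lambda>i. norm (A $ i)) UNIV)"
    by (intro mult_left_mono L2_set_mult_ineq) auto
  also have "\<dots> = norm A * norm G * norm H"
    by (simp add: norm_matrix_columns[of G] norm_vec_def[of A] mult_ac)
  finally show ?thesis .
qed

lemma bounded_bilinear_contract: "bounded_bilinear (contract A)"
proof
  show "contract A (G + G') H = contract A G H + contract A G' H" for G G' H
    by (simp add: contract_eq matrix_vector_mult_add_rdistrib blinfun.add_right sum.distrib)
  show "contract A G (H + H') = contract A G H + contract A G H'" for G H H'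
    by (simp add: contract_eq matrix_vector_mult_add_rdistrib blinfun.add_left sum.distrib)
  show "contract A (c *\<^sub>R G) H = c *\<^sub>R contract A G H" for c G H
    by (simp add: contract_eq scaleR_matrix_vector_assoc[symmetric] blinfun.scaleR_right scaleR_sum_right)
  show "contract A G (c *\<^sub>R H) = c *\<^sub>R contract A G H" for c G H
    by (simp add: contract_eq scaleR_matrix_vector_assoc[symmetric] blinfun.scaleR_left scaleR_sum_right)
  show "\<exists>K. \<forall>G H. norm (contract A G H) \<le> norm G * norm H * K"
    using norm_contract[of A] by (metis mult.assoc mult.commute)
qed

lemma contract_add: "contract (A + B) G H = contract A G H + contract B G H"
  by (simp add: contract_eq matrix_vector_right_distrib sum.distrib)

text \<open>On Chen's tensor the contraction is the derivative of y -> g(y) q in the direction g(y)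
  p, which is the term \<open>f' y (a y)\<close> of \<open>composition_defect\<close>.\<close>

lemma contract_tensor: "contract (tensor p q) G H = blinfun_apply H (G *v p) *v q"
proof -
  have "contract (tensor p q) G H = (\<Sum>i\<in>UNIV. p $ i *\<^sub>R (blinfun_apply H (G *v axis i 1) *v q))"
  proof -
    have "tensor p q $ i = p $ i *\<^sub>R q" for i by (simp add: tensor_def vec_eq_iff)
    then show ?thesis by (simp add: contract_eq matrix_vector_mult_scaleR)
  qed
  also have "\<dots> = blinfun_apply H (\<Sum>i\<in>UNIV. p $ i *\<^sub>R (G *v axis i 1)) *v q"
  proof -
    have l: "linear (\<lambda>u. blinfun_apply H u *v q)"
      by (rule linearI) (simp_all add: blinfun.add_right blinfun.scaleR_right
          matrix_vector_mult_add_rdistrib scaleR_matrix_vector_assoc)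
    show ?thesis
      by (simp add: linear_sum[OF l] linear_cmul[OF l])
  qed
  also have "\<dots> = blinfun_apply H (G *v p) *v q" by (simp add: matrix_vector_sum_axis)
  finally show ?thesis .
qed

subsection \<open>The rough control on a grid\<close>

text \<open>The variation without the final root, since superadditivity holds for the sums of
  powers.\<close>

definition psum ::
    "real \<Rightarrow> (real \<Rightarrow> real \<Rightarrow> 'a::real_normed_vector) \<Rightarrow> real set \<Rightarrow> real \<Rightarrow> real \<Rightarrow> real" where
  "psum r Z G s t =
     (SUP (n, \<sigma>) \<in> partitions G s t. \<Sum>i<n. norm (Z (\<sigma> i) (\<sigma> (Suc i))) powr r)"

lemma partition_strict_mono:
  assumes "(n, \<sigma>) \<in> partitions G s t" "i < j" "j \<le> n"
  shows "\<sigma> i < \<sigma> j"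
  using assms(2,3)
proof (induction j)
  case (Suc j)
  then have "\<sigma> j < \<sigma> (Suc j)" using assms(1) by (auto simp: partitions_def)
  with Suc show ?case by (cases "i = j") auto
qed simp

text \<open>Strict monotonicity makes the pairs of consecutive points distinct, so the sum over all
  pairs of grid points bounds every partition at once and the supremum is a genuine one.\<close>

lemma partition_sum_le:
  assumes "finite (G \<inter> {s..t})" "(n, \<sigma>) \<in> partitions G s t"
  shows "(\<Sum>i<n. norm (Z (\<sigma> i) (\<sigma> (Suc i))) powr r)
    \<le> (\<Sum>(u, v) \<in> (G \<inter> {s..t}) \<times> (G \<inter> {s..t}). norm (Z u v) powr r)"
proof -
  have inj: "inj_on (\<lambda>i. (\<sigma> i, \<sigma> (Suc i))) {..<n}"
  proof (rule inj_onI)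
    fix i j assume "i \<in> {..<n}" "j \<in> {..<n}" "(\<sigma> i, \<sigma> (Suc i)) = (\<sigma> j, \<sigma> (Suc j))"
    then show "i = j"
      using partition_strict_mono[OF assms(2), of i j] partition_strict_mono[OF assms(2), of j i]
      by (cases i j rule: linorder_cases) auto
  qed
  have "(\<Sum>i<n. norm (Z (\<sigma> i) (\<sigma> (Suc i))) powr r)
     = (\<Sum>(u, v) \<in> (\<lambda>i. (\<sigma> i, \<sigma> (Suc i))) ` {..<n}. norm (Z u v) powr r)"
    by (subst sum.reindex[OF inj]) (simp add: o_def)
  also have "\<dots> \<le> (\<Sum>(u, v) \<in> (G \<inter> {s..t}) \<times> (G \<inter> {s..t}). norm (Z u v) powr r)"
    using assms by (intro sum_mono2) (auto simp: partitions_def)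
  finally show ?thesis .
qed

lemma grid_interval_finite:
  assumes "strict_mono (ts :: nat \<Rightarrow> real)"
  shows "finite (range ts \<inter> {ts k..ts l})"
proof -
  have "range ts \<inter> {ts k..ts l} \<subseteq> ts ` {k..l}"
    using strict_mono_less_eq[OF assms] by auto
  then show ?thesis using finite_surj by blast
qed

lemma partition_concat:
  assumes "(n, \<sigma>) \<in> partitions G s u" "(m, \<tau>) \<in> partitions G u t" "s \<le> u" "u \<le> t"
  shows "(n + m, \<lambda>i. if i \<le> n then \<sigma> i else \<tau> (i - n)) \<in> partitions G s t"
proof -
  have \<sigma>: "\<sigma> 0 = s" "\<sigma> n = u" "\<And>i. i < n \<Longrightarrow> \<sigma> i < \<sigma> (Suc i)" "\<And>i. i \<le> n \<Longrightarrow> \<sigma> i \<in> G \<inter> {s..u}"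
    using assms(1) by (auto simp: partitions_def)
  have \<tau>: "\<tau> 0 = u" "\<tau> m = t" "\<And>i. i < m \<Longrightarrow> \<tau> i < \<tau> (Suc i)" "\<And>i. i \<le> m \<Longrightarrow> \<tau> i \<in> G \<inter> {u..t}"
    using assms(2) by (auto simp: partitions_def)
  define \<rho> where "\<rho> = (\<lambda>i. if i \<le> n then \<sigma> i else \<tau> (i - n))"
  have "\<rho> 0 = s" using \<sigma> by (simp add: \<rho>_def)
  moreover have "\<rho> (n + m) = t" using \<sigma> \<tau> by (cases "m = 0") (auto simp: \<rho>_def)
  moreover have "\<rho> i < \<rho> (Suc i)" if i: "i < n + m" for i
  proof -
    consider "i < n" | "i = n" "0 < m" | "n < i" by (cases i n rule: linorder_cases) (use i in auto)
    then show ?thesis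
    proof cases
      case 3
      then show ?thesis using \<tau>(3)[of "i - n"] i by (simp add: \<rho>_def Suc_diff_le)
    qed (use \<sigma> \<tau>(1) \<tau>(3)[of 0] in \<open>auto simp: \<rho>_def\<close>)
  qed
  moreover have "\<rho> i \<in> G \<inter> {s..t}" if "i \<le> n + m" for i
    using \<sigma>(4)[of i] \<tau>(4)[of "i - n"] that assms(3,4) by (auto simp: \<rho>_def le_diff_conv)
  ultimately show ?thesis by (auto simp: partitions_def \<rho>_def[symmetric])
qed

context
  fixes ts :: "nat \<Rightarrow> real" and Z :: "real \<Rightarrow> real \<Rightarrow> 'a::real_normed_vector" and r :: real
  assumes ts: "strict_mono ts"
begin

private abbreviation "Q k l \<equiv> psum r Z (range ts) (ts k) (ts l)"

lemma partition_sum_le_psum: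
  assumes "(n, \<sigma>) \<in> partitions (range ts) (ts k) (ts l)"
  shows "(\<Sum>i<n. norm (Z (\<sigma> i) (\<sigma> (Suc i))) powr r) \<le> Q k l"
proof -
  have "bdd_above ((\<lambda>(n, \<sigma>). \<Sum>i<n. norm (Z (\<sigma> i) (\<sigma> (Suc i))) powr r) ` partitions (range ts) (ts k) (ts l))"
    using partition_sum_le[OF grid_interval_finite[OF ts]]
    by (intro bdd_aboveI2[where M = "\<Sum>(u, v) \<in> (range ts \<inter> {ts k..ts l}) \<times> (range ts \<inter> {ts k..ts l}). norm (Z u v) powr r"])
      auto
  from cSUP_upper[OF assms this] show ?thesis by (simp add: psum_def)
qed

lemma grid_partition:
  assumes "k \<le> l"
  shows "(l - k, \<lambda>i. ts (k + i)) \<in> partitions (range ts) (ts k) (ts l)"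
  using assms strict_mono_less[OF ts] strict_mono_less_eq[OF ts] by (auto simp: partitions_def)

lemma psum_least:
  assumes "k \<le> l"
    and "\<And>n \<sigma>. (n, \<sigma>) \<in> partitions (range ts) (ts k) (ts l)
      \<Longrightarrow> (\<Sum>i<n. norm (Z (\<sigma> i) (\<sigma> (Suc i))) powr r) \<le> B"
  shows "Q k l \<le> B"
  unfolding psum_def using assms grid_partition[OF assms(1)] by (intro cSUP_least) auto

lemma psum_nonneg:
  assumes "k \<le> l"
  shows "0 \<le> Q k l"
  using partition_sum_le_psum[OF grid_partition[OF assms]] by (meson order_trans powr_ge_zero sum_nonneg)

lemma psum_superadditive:
  assumes "k \<le> u" "u \<le> l"
  shows "Q k u + Q u l \<le> Q k l"
proof -
  have le: "ts k \<le> ts u" "ts u \<le> ts l" using assms strict_mono_less_eq[OF ts] by auto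
  define S where "S n \<sigma> = (\<Sum>i<n. norm (Z (\<sigma> i) (\<sigma> (Suc i))) powr r)" for n :: nat and \<sigma>
  have *: "S n \<sigma> + S m \<tau> \<le> Q k l"
    if "(n, \<sigma>) \<in> partitions (range ts) (ts k) (ts u)" "(m, \<tau>) \<in> partitions (range ts) (ts u) (ts l)"
    for n \<sigma> m \<tau>
  proof -
    define \<rho> where "\<rho> = (\<lambda>i. if i \<le> n then \<sigma> i else \<tau> (i - n))"
    have "S (n + m) \<rho> = S n \<sigma> + S m \<tau>"
    proof -
      have "S (n + m) \<rho> = S n \<rho> + (\<Sum>i=n..<n + m. norm (Z (\<rho> i) (\<rho> (Suc i))) powr r)"
        by (simp add: S_def lessThan_atLeast0 sum.atLeastLessThan_concat)
      also have "S n \<rho> = S n \<sigma>" by (simp add: S_def \<rho>_def)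
      also have "(\<Sum>i=n..<n + m. norm (Z (\<rho> i) (\<rho> (Suc i))) powr r) = S m (\<lambda>i. \<rho> (i + n))"
        using sum.shift_bounds_nat_ivl[of "\<lambda>i. norm (Z (\<rho> i) (\<rho> (Suc i))) powr r" 0 n m]
        by (simp add: S_def lessThan_atLeast0 add.commute)
      also have "(\<lambda>i. \<rho> (i + n)) = \<tau>"
        using that by (auto simp: \<rho>_def partitions_def)
      finally show ?thesis .
    qed
    then show ?thesis
      using partition_sum_le_psum[OF partition_concat[OF that le]] by (simp add: S_def \<rho>_def)
  qed
  \<comment> \<open>The supremum is taken over the second partition with the first fixed, then over
    the first.\<close>
  have "Q u l \<le> Q k l - S n \<sigma>" if "(n, \<sigma>) \<in> partitions (range ts) (ts k) (ts u)" for n \<sigma>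
    using *[OF that] by (intro psum_least assms) (auto simp: S_def algebra_simps)
  then have "Q k u \<le> Q k l - Q u l"
    by (intro psum_least assms) (auto simp: S_def algebra_simps)
  then show ?thesis by simp
qed

lemma norm_le_psum:
  assumes "k < l"
  shows "norm (Z (ts k) (ts l)) powr r \<le> Q k l"
proof -
  have "(1, \<lambda>i. if i = 0 then ts k else ts l) \<in> partitions (range ts) (ts k) (ts l)"
    using assms strict_mono_less[OF ts] by (auto simp: partitions_def less_imp_le)
  from partition_sum_le_psum[OF this] show ?thesis by simp
qed

lemma dvar_powr:
  assumes "k \<le> l" "0 < r"
  shows "dvar r Z (range ts) (ts k) (ts l) powr r = Q k l"
  using psum_nonneg[OF assms(1)] assms(2)
  by (simp add: dvar_def psum_def[symmetric] powr_powr)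

end

text \<open>The p-th power of \<open>rough_dvar\<close>; the exponents p and p/2 put both levels on
  one scale, so the sum is a single control.\<close>

definition rough_control ::
    "real \<Rightarrow> (real \<Rightarrow> real^'m) \<Rightarrow> (real \<Rightarrow> real \<Rightarrow> real^'m^'m) \<Rightarrow> (nat \<Rightarrow> real) \<Rightarrow> nat \<Rightarrow> nat \<Rightarrow> real" where
  "rough_control p x X ts k l =
     psum p (incr x) (range ts) (ts k) (ts l) + psum (p/2) X (range ts) (ts k) (ts l)"

context
  fixes ts :: "nat \<Rightarrow> real" and x :: "real \<Rightarrow> real^'m" and X :: "real \<Rightarrow> real \<Rightarrow> real^'m^'m" and p :: real
  assumes ts: "strict_mono ts" and p: "0 < p"
begin

private abbreviation "\<omega> \<equiv> rough_control p x X ts"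
private abbreviation "R k l \<equiv> rough_dvar p x X (range ts) (ts k) (ts l)"

lemma control_nonneg: "k \<le> l \<Longrightarrow> 0 \<le> \<omega> k l"
  by (simp add: rough_control_def psum_nonneg[OF ts])

lemma control_superadditive: "k \<le> u \<Longrightarrow> u \<le> l \<Longrightarrow> \<omega> k u + \<omega> u l \<le> \<omega> k l"
  using psum_superadditive[OF ts, of k u l p "incr x"] psum_superadditive[OF ts, of k u l "p/2" X]
  by (simp add: rough_control_def)

lemma control_same: "\<omega> k k = 0"
  using control_superadditive[of k k k] control_nonneg[of k k] by simp

lemma control_mono: "k' \<le> k \<Longrightarrow> k \<le> l \<Longrightarrow> l \<le> l' \<Longrightarrow> \<omega> k l \<le> \<omega> k' l'"
  using control_superadditive[of k' k l'] control_superadditive[of k l l']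
    control_nonneg[of k' k] control_nonneg[of l l'] by linarith

lemma rough_dvar_control: "k \<le> l \<Longrightarrow> R k l = \<omega> k l powr (1/p)"
  using p by (simp add: rough_dvar_def rough_control_def dvar_powr[OF ts])

lemma rough_dvar_mono: "k' \<le> k \<Longrightarrow> k \<le> l \<Longrightarrow> l \<le> l' \<Longrightarrow> R k l \<le> R k' l'"
  using p by (simp add: rough_dvar_control powr_mono2 control_nonneg control_mono)

text \<open>Take for \<open>u\<close> the last index up to which at most half of the control is
  spent. Either \<open>Suc u\<close> is the end, or more than half is spent by then and
  superadditivity leaves at most half. The step from \<open>u\<close> to \<open>Suc u\<close> itself
  may be large.\<close>

lemma rough_dvar_split:
  assumes "k < l"
  shows "\<exists>u. k \<le> u \<and> u < l \<and> R k u \<le> (1/2) powr (1/p) * R k l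
    \<and> R (Suc u) l \<le> (1/2) powr (1/p) * R k l"
proof -
  define U where "U = {u. k \<le> u \<and> u < l \<and> \<omega> k u \<le> \<omega> k l / 2}"
  have fin: "finite U" and ne: "U \<noteq> {}"
    using assms control_same[of k] control_nonneg[of k l] by (auto simp: U_def)
  define u where "u = Max U"
  have u: "k \<le> u" "u < l" "\<omega> k u \<le> \<omega> k l / 2"
    using Max_in[OF fin ne] by (auto simp: u_def U_def)
  have "\<omega> (Suc u) l \<le> \<omega> k l / 2"
  proof (cases "Suc u = l")
    case True
    then show ?thesis using control_same control_nonneg[of k l] assms by simp
  next
    case False
    have "Suc u \<notin> U" using Max_ge[OF fin, of "Suc u"] by (auto simp: u_def)
    then have "\<omega> k l / 2 < \<omega> k (Suc u)" using u False by (auto simp: U_def)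
    then show ?thesis using control_superadditive[of k "Suc u" l] u by simp
  qed
  moreover have "R i j \<le> (1/2) powr (1/p) * R k l" if "i \<le> j" "\<omega> i j \<le> \<omega> k l / 2" for i j
  proof -
    have "R i j \<le> (1/2 * \<omega> k l) powr (1/p)"
      using that p by (simp add: rough_dvar_control powr_mono2 control_nonneg)
    also have "\<dots> = (1/2) powr (1/p) * \<omega> k l powr (1/p)"
      using control_nonneg[of k l] assms by (intro powr_mult)
    finally show ?thesis using assms by (simp add: rough_dvar_control)
  qed
  ultimately show ?thesis using u by (intro exI[of _ u]) auto
qed

lemma norm_incr_le: "k \<le> l \<Longrightarrow> norm (incr x (ts k) (ts l)) \<le> R k l"
proof (cases "k = l")
  case False
  assume "k \<le> l"
  then have "norm (incr x (ts k) (ts l)) powr p \<le> \<omega> k l"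
    using norm_le_psum[OF ts, of k l "incr x" p] psum_nonneg[OF ts, of k l "p/2" X] False
    by (simp add: rough_control_def)
  then have "(norm (incr x (ts k) (ts l)) powr p) powr (1/p) \<le> \<omega> k l powr (1/p)"
    using p by (intro powr_mono2) auto
  then show ?thesis using p \<open>k \<le> l\<close> by (simp add: powr_powr rough_dvar_control)
qed (simp add: incr_def rough_dvar_def)

text \<open>The root 2/p turns the control into the square of R. For k = l a strict partition sees
  no increment, so the diagonal value must be known to vanish.\<close>

lemma norm_second_le:
  assumes "k \<le> l" "X (ts k) (ts k) = 0"
  shows "norm (X (ts k) (ts l)) \<le> (R k l)\<^sup>2"
proof (cases "k = l")
  case False
  then have "norm (X (ts k) (ts l)) powr (p/2) \<le> \<omega> k l"
    using norm_le_psum[OF ts, of k l X "p/2"] psum_nonneg[OF ts, of k l p "incr x"] assms(1)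
    by (simp add: rough_control_def)
  then have "(norm (X (ts k) (ts l)) powr (p/2)) powr (2/p) \<le> \<omega> k l powr (2/p)"
    using p by (intro powr_mono2) auto
  also have "\<omega> k l powr (2/p) = (\<omega> k l powr (1/p)) powr 2" by (simp add: powr_powr)
  also have "\<dots> = (R k l)\<^sup>2" using assms(1) by (simp add: rough_dvar_control powr_numeral)
  finally show ?thesis using p by (simp add: powr_powr)
qed (use assms in auto)

end

lemma norm_le_rough_norm:
  assumes "0 < p"
  shows "norm (incr x s t) \<le> rough_norm p x X s t" "norm (X s t) \<le> (rough_norm p x X s t)\<^sup>2"
proof -
  define w where "w = norm (incr x s t) powr p + norm (X s t) powr (p/2)"
  have w: "rough_norm p x X s t = w powr (1/p)" by (simp add: rough_norm_def w_def)
  have "(norm (incr x s t) powr p) powr (1/p) \<le> w powr (1/p)"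
    using assms by (intro powr_mono2) (auto simp: w_def)
  then show "norm (incr x s t) \<le> rough_norm p x X s t" using assms by (simp add: powr_powr w)
  have "(norm (X s t) powr (p/2)) powr (2/p) \<le> w powr (2/p)"
    using assms by (intro powr_mono2) (auto simp: w_def)
  also have "w powr (2/p) = (w powr (1/p)) powr 2" by (simp add: powr_powr)
  also have "\<dots> = (rough_norm p x X s t)\<^sup>2" by (simp add: w powr_numeral)
  finally show "norm (X s t) \<le> (rough_norm p x X s t)\<^sup>2" using assms by (simp add: powr_powr)
qed

subsection \<open>Davie expansions\<close>

lemma norm_le_sup_norm: "bounded (range h) \<Longrightarrow> norm (h z) \<le> sup_norm h"
  unfolding sup_norm_def
  by (rule cSUP_upper) (use bounded_norm_comp[of "\<lambda>x. x" "range h"] in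
      \<open>auto simp: image_image bounded_imp_bdd_above\<close>)

lemma C3_const_bounds:
  assumes "C3_bounded g Dg D2g D3g"
  shows "norm (g z) \<le> C3_const g Dg D2g D3g" "norm (Dg z) \<le> C3_const g Dg D2g D3g"
    "norm (D2g z) \<le> C3_const g Dg D2g D3g" "norm (D3g z) \<le> C3_const g Dg D2g D3g"
proof -
  have "bounded (range g)" "bounded (range Dg)" "bounded (range D2g)" "bounded (range D3g)"
    using assms by (auto simp: C3_bounded_def)
  from this[THEN norm_le_sup_norm, of z]
  show "norm (g z) \<le> C3_const g Dg D2g D3g" "norm (Dg z) \<le> C3_const g Dg D2g D3g"
    "norm (D2g z) \<le> C3_const g Dg D2g D3g" "norm (D3g z) \<le> C3_const g Dg D2g D3g"
    by (auto simp: C3_const_def)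
qed

locale C3_coefficient =
  fixes g :: "real^'d \<Rightarrow> real^'m^'d" and Dg D2g D3g and c :: real
  assumes C3: "C3_bounded g Dg D2g D3g"
    and bound: "\<And>z. norm (g z) \<le> c" "\<And>z. norm (Dg z) \<le> c" "\<And>z. norm (D2g z) \<le> c"
      "\<And>z. norm (D3g z) \<le> c"
begin

lemma deriv: "(g has_derivative Dg z) (at z)" "(Dg has_derivative D2g z) (at z)"
    "(D2g has_derivative D3g z) (at z)"
  using C3 by (auto simp: C3_bounded_def)

lemma c_nonneg: "0 \<le> c"
  using bound(1)[of undefined] norm_ge_zero order_trans by blast

lemma blinfun_bound: "norm (Dg z v) \<le> c * norm v" "norm (D2g z v) \<le> c * norm v"
    "norm (D3g z v) \<le> c * norm v"
  using bound(2,3,4)[of z] by (meson norm_blinfun mult_right_mono norm_ge_zero order_trans)+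

lemma lip: "norm (g y - g y') \<le> c * norm (y - y')" "norm (Dg y - Dg y') \<le> c * norm (y - y')"
    "norm (D2g y - D2g y') \<le> c * norm (y - y')"
  using c_nonneg
  by (auto intro!: lipschitz_of_derivative[where S = UNIV] deriv blinfun_bound)

lemma Dg_second_difference:
  "norm (Dg (y + h) - Dg y - (Dg (y' + h) - Dg y')) \<le> c * norm h * norm (y - y')"
proof (rule second_difference[where f = Dg and f' = "\<lambda>z. blinfun_apply (D2g z)"])
  show "norm (D2g z v - D2g z' v) \<le> c * norm (z - z') * norm v" for z z' v
    using norm_blinfun[of "D2g z - D2g z'" v] lip(3)[of z z']
    by (simp add: blinfun.diff_left) (meson mult_right_mono norm_ge_zero order_trans)
qed (auto simp: deriv c_nonneg)

abbreviation "G1 x y \<equiv> g y *v x"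
abbreviation "dG1 x y v \<equiv> blinfun_apply (Dg y) v *v x"

lemma bl_mult: "bounded_linear (\<lambda>G :: real^'m^'d. G *v x)"
proof (rule bounded_linear_intro[where K = "norm x"])
  show "norm (G *v x) \<le> norm G * norm x" for G :: "real^'m^'d" by (rule norm_matrix_vector_mult)
qed (simp_all add: matrix_vector_mult_add_rdistrib scaleR_matrix_vector_assoc)

text \<open>Everything is linear in x, so each bound on g and its derivatives picks up the factor c
  * norm x <= \<alpha>.\<close>

lemma first_order_estimates:
  assumes "c * norm x \<le> \<alpha>"
  shows "norm (G1 x y) \<le> \<alpha>"
    and "norm (G1 x y - G1 x y') \<le> \<alpha> * norm (y - y')"
    and "(G1 x has_derivative dG1 x y) (at y)"
    and "norm (dG1 x y v) \<le> \<alpha> * norm v"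
    and "norm (dG1 x y v - dG1 x y' v) \<le> \<alpha> * norm (y - y') * norm v"
    and "norm (dG1 x (y + k) v - dG1 x y v - (dG1 x (y' + k) v - dG1 x y' v))
      \<le> \<alpha> * norm k * norm (y - y') * norm v"
proof -
  have *: "norm (G *v x) \<le> \<alpha> * B" if "norm G \<le> c * B" "0 \<le> B" for G :: "real^'m^'d" and B
  proof -
    have "norm (G *v x) \<le> norm G * norm x" by (rule norm_matrix_vector_mult)
    also have "\<dots> \<le> c * B * norm x" using that by (intro mult_right_mono) auto
    also have "\<dots> = (c * norm x) * B" by simp
    also have "\<dots> \<le> \<alpha> * B" using assms that by (intro mult_right_mono) auto
    finally show ?thesis .
  qed
  have **: "norm (blinfun_apply H v) \<le> c * (B * norm v)" if "norm H \<le> c * B"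
    for H :: "(real^'d) \<Rightarrow>\<^sub>L (real^'m^'d)" and B v
    using norm_blinfun[of H v] mult_right_mono[OF that, of "norm v"] by simp
  show "norm (G1 x y) \<le> \<alpha>" using *[of "g y" 1] bound by simp
  show "norm (G1 x y - G1 x y') \<le> \<alpha> * norm (y - y')"
    using *[of "g y - g y'" "norm (y - y')"] lip by (simp add: matrix_vector_mult_diff_rdistrib)
  show "(G1 x has_derivative dG1 x y) (at y)"
    by (rule bounded_linear.has_derivative[OF bl_mult deriv(1)])
  show "norm (dG1 x y v) \<le> \<alpha> * norm v" using *[OF blinfun_bound(1)] by simp
  show "norm (dG1 x y v - dG1 x y' v) \<le> \<alpha> * norm (y - y') * norm v"
    using *[OF **[OF lip(2)], of y y' v]
    by (simp add: matrix_vector_mult_diff_rdistrib blinfun.diff_left mult.assoc)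
  show "norm (dG1 x (y + k) v - dG1 x y v - (dG1 x (y' + k) v - dG1 x y' v))
      \<le> \<alpha> * norm k * norm (y - y') * norm v"
    using *[OF **, of "Dg (y + k) - Dg y - (Dg (y' + k) - Dg y')" "norm k * norm (y - y')" v]
      Dg_second_difference[of y k y']
    by (simp add: matrix_vector_mult_diff_rdistrib blinfun.diff_left mult.assoc)
qed

abbreviation "G2 A y \<equiv> second_order g Dg y A"

lemma norm_contract_le:
  assumes "c\<^sup>2 * norm A \<le> \<beta>" "norm G \<le> c * B1" "norm H \<le> c * B2" "0 \<le> B1" "0 \<le> B2"
  shows "norm (contract A G H) \<le> \<beta> * (B1 * B2)"
proof -
  have "norm (contract A G H) \<le> norm A * norm G * norm H" by (rule norm_contract)
  also have "\<dots> \<le> norm A * (c * B1) * (c * B2)"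
    using assms c_nonneg by (intro mult_mono mult_left_mono) auto
  also have "\<dots> = (c\<^sup>2 * norm A) * (B1 * B2)" by (simp add: power2_eq_square)
  also have "\<dots> \<le> \<beta> * (B1 * B2)" using assms by (intro mult_right_mono) auto
  finally show ?thesis .
qed

text \<open>By bilinearity a difference of the product of g and Dg has two terms, and a difference
  of its derivative has four; hence the factors 2 and 4.\<close>

lemma second_order_estimates:
  assumes A: "c\<^sup>2 * norm A \<le> \<beta>"
  shows "norm (G2 A y) \<le> \<beta>"
    and "norm (G2 A y - G2 A y') \<le> 2 * \<beta> * norm (y - y')"
    and "norm (G2 A (y + h) - G2 A y - (G2 A (y' + h) - G2 A y')) \<le> 4 * \<beta> * norm h * norm (y - y')"
proof -
  interpret B: bounded_bilinear "contract A" by (rule bounded_bilinear_contract)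
  have \<beta>: "0 \<le> \<beta>" using A by (meson mult_nonneg_nonneg norm_ge_zero order_trans zero_le_power2)
  have G2: "G2 A = (\<lambda>y. contract A (g y) (Dg y))" by (simp add: second_order_contract fun_eq_iff)
  have b: "norm (g z) \<le> c * 1" "norm (Dg z) \<le> c * 1" for z using bound by auto
  show "norm (G2 A y) \<le> \<beta>"
    using norm_contract_le[OF A b zero_le_one zero_le_one] by (simp add: second_order_contract)
  have "G2 A y - G2 A y' = contract A (g y - g y') (Dg y) + contract A (g y') (Dg y - Dg y')"
    by (simp add: second_order_contract B.diff_left B.diff_right)
  also have "norm \<dots> \<le> \<beta> * (norm (y - y') * 1) + \<beta> * (1 * norm (y - y'))"
    by (intro norm_triangle_mono norm_contract_le[OF A] b lip norm_ge_zero zero_le_one)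
  finally show "norm (G2 A y - G2 A y') \<le> 2 * \<beta> * norm (y - y')" by simp
  show "norm (G2 A (y + h) - G2 A y - (G2 A (y' + h) - G2 A y')) \<le> 4 * \<beta> * norm h * norm (y - y')"
  proof (rule second_difference[where f = "G2 A"])
    show "(G2 A has_derivative (\<lambda>v. contract A (g z) (D2g z v) + contract A (Dg z v) (Dg z))) (at z)" for z
      unfolding G2 by (rule B.FDERIV[OF deriv(1,2)])
    fix z z' v
    have D2: "norm (D2g z v - D2g z' v) \<le> c * (norm (z - z') * norm v)"
      using norm_blinfun[of "D2g z - D2g z'" v] mult_right_mono[OF lip(3), of "norm v" z z']
      by (simp add: blinfun.diff_left)
    have D1: "norm (Dg z v - Dg z' v) \<le> c * (norm (z - z') * norm v)"
      using norm_blinfun[of "Dg z - Dg z'" v] mult_right_mono[OF lip(2), of "norm v" z z']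
      by (simp add: blinfun.diff_left)
    have "contract A (g z) (D2g z v) + contract A (Dg z v) (Dg z)
        - (contract A (g z') (D2g z' v) + contract A (Dg z' v) (Dg z'))
      = contract A (g z - g z') (D2g z v) + contract A (g z') (D2g z v - D2g z' v)
        + contract A (Dg z v - Dg z' v) (Dg z) + contract A (Dg z' v) (Dg z - Dg z')"
      by (simp add: B.diff_left B.diff_right)
    also have "norm \<dots> \<le> \<beta> * (norm (z - z') * norm v) + \<beta> * (1 * (norm (z - z') * norm v))
        + \<beta> * ((norm (z - z') * norm v) * 1) + \<beta> * (norm v * norm (z - z'))"
      by (intro norm_triangle_mono norm_contract_le[OF A] b lip blinfun_bound D1 D2
          norm_ge_zero zero_le_one mult_nonneg_nonneg)
    finally show "norm (contract A (g z) (D2g z v) + contract A (Dg z v) (Dg z)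
        - (contract A (g z') (D2g z' v) + contract A (Dg z' v) (Dg z')))
        \<le> 4 * \<beta> * norm (z - z') * norm v" by (simp add: algebra_simps)
  qed (use \<beta> in simp)
qed

end

text \<open>Increment of the scheme without drift if the whole interval is taken in one
  step.\<close>

definition davie ::
    "(real^'d \<Rightarrow> real^'m^'d) \<Rightarrow> (real^'d \<Rightarrow> (real^'d) \<Rightarrow>\<^sub>L (real^'m^'d)) \<Rightarrow> (real \<Rightarrow> real^'m) \<Rightarrow>
     (real \<Rightarrow> real \<Rightarrow> real^'m^'m) \<Rightarrow> (nat \<Rightarrow> real) \<Rightarrow> nat \<Rightarrow> nat \<Rightarrow> real^'d \<Rightarrow> real^'d" where
  "davie g Dg x X ts k l y =
     g y *v incr x (ts k) (ts l) + second_order g Dg y (X (ts k) (ts l))"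

context C3_coefficient
begin

text \<open>For \<alpha> = c R <= \<epsilon> <= 1/4 the first- and second-order bounds add up to at
  most \<alpha> + 4 \<alpha>^2 <= 2 \<epsilon>, and \<open>composition_defect\<close> gives D = 23.
  The condition 12 \<epsilon> <= s is \<open>eta_s\<close>; 92 \<epsilon>^2 <= s yields
  \<open>A_small\<close>, because 8 * 23 * \<epsilon>^3 = 2 \<epsilon> * 92 \<epsilon>^2.\<close>

lemma almost_flow_davie:
  fixes x :: "real \<Rightarrow> real^'m" and X :: "real \<Rightarrow> real \<Rightarrow> real^'m^'m"
  assumes ts: "strict_mono ts" "0 \<le> ts 0" and p: "0 < p" "p < 3"
    and chen: "\<And>s u t. 0 \<le> s \<Longrightarrow> s \<le> u \<Longrightarrow> u \<le> t \<Longrightarrow>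
        X s t - X s u - X u t = tensor (incr x s u) (incr x u t)"
    and ab: "a \<le> b" and \<epsilon>: "c * rough_dvar p x X (range ts) (ts a) (ts b) \<le> \<epsilon>"
    and s: "s = 1 - 2 * (1/2) powr (3/p)" and small: "12 * \<epsilon> \<le> s" "92 * \<epsilon>\<^sup>2 \<le> s" "\<epsilon> \<le> 1/4"
    and \<epsilon>_pos: "0 < \<epsilon>"
  shows "almost_flow (davie g Dg x X ts)
    (\<lambda>k l. (c * rough_dvar p x X (range ts) (ts k) (ts l))^3) a b (2 * \<epsilon>) ((1/2) powr (3/p)) s 23" (is ?flow)
    and "a \<le> k \<Longrightarrow> k \<le> l \<Longrightarrow> l \<le> b \<Longrightarrow> norm (davie g Dg x X ts k l y) \<le> 2 * \<epsilon>"
proof -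
  define R where "R k l = rough_dvar p x X (range ts) (ts k) (ts l)" for k l
  define \<alpha> where "\<alpha> k l = c * R k l" for k l
  have R0: "0 \<le> R k l" for k l by (simp add: R_def rough_dvar_def)
  have \<alpha>0: "0 \<le> \<alpha> k l" for k l using R0 c_nonneg by (simp add: \<alpha>_def)
  have \<alpha>_mono: "\<alpha> k l \<le> \<alpha> k' l'" if "k' \<le> k" "k \<le> l" "l \<le> l'" for k l k' l'
    using rough_dvar_mono[OF ts(1) p(1) that, of x X] c_nonneg by (simp add: \<alpha>_def R_def mult_left_mono)
  have \<alpha>_le: "\<alpha> k l \<le> \<epsilon>" if "a \<le> k" "k \<le> l" "l \<le> b" for k l
    using \<alpha>_mono[OF that] \<epsilon> by (simp add: \<alpha>_def R_def)
  have ts0: "0 \<le> ts k" for k using ts strict_mono_less_eq[OF ts(1), of 0 k] by simp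
  \<comment> \<open>Chen's relation with all three times equal.\<close>
  have X0: "X (ts k) (ts k) = 0" for k
    using chen[of "ts k" "ts k" "ts k"] ts0[of k] by (simp add: incr_def tensor_def vec_eq_iff)
  have x\<alpha>: "c * norm (incr x (ts k) (ts l)) \<le> \<alpha> k l" if "k \<le> l" for k l
    using norm_incr_le[OF ts(1) p(1) that, of x X] c_nonneg by (simp add: \<alpha>_def R_def mult_left_mono)
  have X\<alpha>: "c\<^sup>2 * norm (X (ts k) (ts l)) \<le> (\<alpha> k l)\<^sup>2" if "k \<le> l" for k l
    using norm_second_le[where ts = ts and X = X and x = x, OF ts(1) p(1) that X0]
    by (simp add: \<alpha>_def R_def mult_left_mono power_mult_distrib)
  define r where "r = davie g Dg x X ts"
  have sq: "4 * (\<alpha> k l)\<^sup>2 \<le> \<epsilon>" if "a \<le> k" "k \<le> l" "l \<le> b" for k l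
  proof -
    have "\<alpha> k l * \<alpha> k l \<le> \<epsilon> * (1/4)"
      using \<alpha>_le[OF that] \<alpha>0 small \<epsilon>_pos by (intro mult_mono) auto
    then show ?thesis by (simp add: power2_eq_square)
  qed
  have defect: "norm (r k u y + r u l (y + r k u y) - r k l y) \<le> 23 * (\<alpha> k l)^3"
    "norm ((r k u y + r u l (y + r k u y) - r k l y) - (r k u y' + r u l (y' + r k u y') - r k l y'))
      \<le> 23 * (\<alpha> k l)^3 * norm (y - y')"
    if *: "a \<le> k" "k \<le> u" "u \<le> l" "l \<le> b" for k u l y y'
  proof -
    define x1 x2 where "x1 = incr x (ts k) (ts u)" "x2 = incr x (ts u) (ts l)"
    define X1 X2 where "X1 = X (ts k) (ts u)" "X2 = X (ts u) (ts l)"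
    have kl: "k \<le> l" using * by simp
    have "ts k \<le> ts u" "ts u \<le> ts l" using * strict_mono_less_eq[OF ts(1)] by auto
    then have X12: "X (ts k) (ts l) = X1 + X2 + tensor x1 x2"
      using chen[of "ts k" "ts u" "ts l"] ts0 by (simp add: x1_x2_def X1_X2_def algebra_simps)
    have x12: "incr x (ts k) (ts l) = x1 + x2" by (simp add: x1_x2_def incr_def)
    \<comment> \<open>By Chen's relation the second-order term of the whole interval is the sum of
      the two parts and the derivative term along the first increment.\<close>
    have E: "r k u y + r u l (y + r k u y) - r k l y
      = (g y *v x1 + G2 X1 y) + (g (y + (g y *v x1 + G2 X1 y)) *v x2 + G2 X2 (y + (g y *v x1 + G2 X1 y)))
        - (g y *v x1 + g y *v x2 + (G2 X1 y + G2 X2 y + Dg y (g y *v x1) *v x2))" for y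
      by (simp add: r_def davie_def X12 x12 x1_x2_def[symmetric] X1_X2_def[symmetric]
        second_order_contract contract_add contract_tensor matrix_vector_right_distrib)
    have b: "c * norm x1 \<le> \<alpha> k l" "c * norm x2 \<le> \<alpha> k l"
      using x\<alpha>[OF *(2)] x\<alpha>[OF *(3)] \<alpha>_mono[of k k u l] \<alpha>_mono[of k u l l] *
      by (auto simp: x1_x2_def)
    have "(\<alpha> k u)\<^sup>2 \<le> (\<alpha> k l)\<^sup>2" "(\<alpha> u l)\<^sup>2 \<le> (\<alpha> k l)\<^sup>2"
      using \<alpha>_mono[of k k u l] \<alpha>_mono[of k u l l] * \<alpha>0 by (auto intro!: power_mono)
    then have B: "c\<^sup>2 * norm X1 \<le> (\<alpha> k l)\<^sup>2" "c\<^sup>2 * norm X2 \<le> (\<alpha> k l)\<^sup>2"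
      using X\<alpha>[OF *(2)] X\<alpha>[OF *(3)] by (auto simp: X1_X2_def)
    have \<alpha>2: "\<alpha> k l \<le> 1/2" using \<alpha>_le[of k l] * small by simp
    note cd = composition_defect[where a = "G1 x1" and b = "G2 X1" and f = "G1 x2" and f' = "dG1 x2"
        and c = "G2 X2" and E = "\<lambda>y. r k u y + r u l (y + r k u y) - r k l y",
        OF \<alpha>0 \<alpha>2 first_order_estimates(1,2)[OF b(1)]
          second_order_estimates(1,2)[OF B(1)] first_order_estimates(3-6)[OF b(2)]
          second_order_estimates(2,3)[OF B(2)] E]
    show "norm (r k u y + r u l (y + r k u y) - r k l y) \<le> 23 * (\<alpha> k l)^3"
      by (rule cd(1))
    show "norm ((r k u y + r u l (y + r k u y) - r k l y) - (r k u y' + r u l (y' + r k u y') - r k l y'))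
      \<le> 23 * (\<alpha> k l)^3 * norm (y - y')"
      by (rule cd(2))
  qed
  show "norm (davie g Dg x X ts k l y) \<le> 2 * \<epsilon>" if *: "a \<le> k" "k \<le> l" "l \<le> b"
  proof -
    have "norm (davie g Dg x X ts k l y) \<le> \<alpha> k l + (\<alpha> k l)\<^sup>2"
      unfolding davie_def
      by (rule norm_triangle_mono[OF first_order_estimates(1)[OF x\<alpha>[OF *(2)]]
            second_order_estimates(1)[OF X\<alpha>[OF *(2)]]])
    then show ?thesis using sq[OF *] \<alpha>_le[OF *] \<epsilon>_pos by simp
  qed
  show ?flow
    unfolding R_def[symmetric] \<alpha>_def[symmetric] r_def[symmetric]
  proof
    show "0 \<le> (\<alpha> k l)^3" for k l using \<alpha>0 by simp
    show "(\<alpha> k l)^3 \<le> (\<alpha> k' l')^3" if "a \<le> k'" "k' \<le> k" "k \<le> l" "l \<le> l'" "l' \<le> b" for k k' l l'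
      using that by (intro power_mono \<alpha>_mono \<alpha>0)
    have cube: "((1/2) powr (1/p) * w)^3 = (1/2) powr (3/p) * w^3" for w :: real
    proof -
      have "((1/2::real) powr (1/p))^3 = ((1/2) powr (1/p)) powr 3" by (simp add: powr_numeral)
      also have "\<dots> = (1/2) powr (3/p)" by (simp add: powr_powr)
      finally show ?thesis by (simp add: power_mult_distrib)
    qed
    have *: "(\<alpha> i j)^3 \<le> (1/2) powr (3/p) * (\<alpha> k l)^3" if "R i j \<le> (1/2) powr (1/p) * R k l" for i j k l
    proof -
      have "\<alpha> i j \<le> (1/2) powr (1/p) * \<alpha> k l"
        using mult_left_mono[OF that c_nonneg] by (simp add: \<alpha>_def mult_ac)
      then have "(\<alpha> i j)^3 \<le> ((1/2) powr (1/p) * \<alpha> k l)^3" using \<alpha>0 by (intro power_mono)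
      then show ?thesis by (simp add: cube)
    qed
    show "\<exists>u. k \<le> u \<and> u < l \<and> (\<alpha> k u)^3 \<le> (1/2) powr (3/p) * (\<alpha> k l)^3
        \<and> (\<alpha> (Suc u) l)^3 \<le> (1/2) powr (3/p) * (\<alpha> k l)^3" if "a \<le> k" "k < l" "l \<le> b" for k l
      using rough_dvar_split[OF ts(1) p(1) that(2), of x X] * unfolding R_def by blast
    show "r k k y = 0" for k y
      by (simp add: r_def davie_def incr_def X0 second_order_def)
    show "norm (r k l y - r k l y') \<le> 2 * \<epsilon> * norm (y - y')"
      if *: "a \<le> k" "k \<le> l" "l \<le> b" for k l y y'
    proof -
      have "norm (r k l y - r k l y') \<le> \<alpha> k l * norm (y - y') + 2 * (\<alpha> k l)\<^sup>2 * norm (y - y')"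
        using norm_triangle_mono[OF first_order_estimates(2)[OF x\<alpha>[OF *(2)]]
            second_order_estimates(2)[OF X\<alpha>[OF *(2)]], of y y' y y']
        by (simp add: r_def davie_def algebra_simps)
      also have "\<dots> = (\<alpha> k l + 2 * (\<alpha> k l)\<^sup>2) * norm (y - y')" by (simp add: algebra_simps)
      also have "\<dots> \<le> 2 * \<epsilon> * norm (y - y')"
        using sq[OF *] \<alpha>_le[OF *] \<epsilon>_pos by (intro mult_right_mono) auto
      finally show ?thesis .
    qed
    show "norm (r k l (y + h) - r k l y - (r k l (y' + h) - r k l y')) \<le> 2 * \<epsilon> * norm h * norm (y - y')"
      if *: "a \<le> k" "k \<le> l" "l \<le> b" for k l y y' h
    proof -
      have "norm (g (y + h) *v incr x (ts k) (ts l) - g y *v incr x (ts k) (ts l)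
        - (g (y' + h) *v incr x (ts k) (ts l) - g y' *v incr x (ts k) (ts l)))
        \<le> \<alpha> k l * norm h * norm (y - y')"
        by (rule second_difference[OF first_order_estimates(3,5)]) (use x\<alpha>[OF *(2)] \<alpha>0 in auto)
      from norm_triangle_mono[OF this second_order_estimates(3)[OF X\<alpha>[OF *(2)]], of y h y']
      have "norm (r k l (y + h) - r k l y - (r k l (y' + h) - r k l y'))
        \<le> \<alpha> k l * norm h * norm (y - y') + 4 * (\<alpha> k l)\<^sup>2 * norm h * norm (y - y')"
        by (simp add: r_def davie_def algebra_simps)
      also have "\<dots> = (\<alpha> k l + 4 * (\<alpha> k l)\<^sup>2) * (norm h * norm (y - y'))" by (simp add: algebra_simps)
      also have "\<dots> \<le> 2 * \<epsilon> * (norm h * norm (y - y'))"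
        using sq[OF *] \<alpha>_le[OF *] \<epsilon>_pos by (intro mult_right_mono) auto
      finally show ?thesis by simp
    qed
    \<comment> \<open>Here p < 3 enters: the exponent 3/p exceeds 1.\<close>
    have "(1/2::real) powr (3/p) < (1/2) powr 1" using p by (intro powr_less_mono') auto
    then show "0 < s" by (simp add: s)
    show "8 * 23 / s * (\<alpha> a b)^3 \<le> 2 * \<epsilon>"
    proof -
      have "184 * (\<alpha> a b)^3 \<le> 184 * \<epsilon>^3"
        using \<alpha>_le[of a b] ab \<alpha>0 by (intro mult_left_mono power_mono) auto
      also have "\<dots> = 2 * \<epsilon> * (92 * \<epsilon>\<^sup>2)" by (simp add: power3_eq_cube power2_eq_square)
      also have "\<dots> \<le> 2 * \<epsilon> * s" using small \<epsilon>_pos by (intro mult_left_mono) auto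
      finally show ?thesis using \<open>0 < s\<close> by (simp add: field_simps)
    qed
  qed (use defect s small \<epsilon>_pos in auto)
qed

end

subsection \<open>Lyapunov functions along the drift\<close>

text \<open>The preimage is the fixed point of the contraction z -> y - \<rho> z.\<close>

lemma perturbed_identity_surj:
  fixes \<rho> :: "'a::{real_normed_vector,complete_space} \<Rightarrow> 'a"
  assumes "0 \<le> \<kappa>" "\<kappa> < 1" "\<And>y y'. norm (\<rho> y - \<rho> y') \<le> \<kappa> * norm (y - y')"
  shows "\<exists>z. z + \<rho> z = y"
proof -
  have "\<exists>!z. y - \<rho> z = z"
  proof (rule banach_fix_type[OF assms(1,2)], intro allI)
    show "dist (y - \<rho> u) (y - \<rho> v) \<le> \<kappa> * dist u v" for u v
      using assms(3)[of v u] by (simp add: dist_norm norm_minus_commute)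
  qed
  then obtain z where "y - \<rho> z = z" by blast
  then have "y = z + \<rho> z" by (rule iffD1[OF diff_eq_eq])
  then show ?thesis by blast
qed

text \<open>Adding C / \<delta> makes the differential inequality homogeneous, so the exponentially
  discounted value is nonincreasing along the segment.\<close>

lemma gronwall_segment:
  assumes grad: "\<And>z. GDERIV V z :> G z" and \<delta>: "0 < \<delta>"
    and le: "\<And>\<theta>. 0 \<le> \<theta> \<Longrightarrow> \<theta> \<le> 1 \<Longrightarrow>
      inner (G (z + \<theta> *\<^sub>R \<Delta>)) \<Delta> \<le> h * (C + \<delta> * V (z + \<theta> *\<^sub>R \<Delta>))"
  shows "V (z + \<Delta>) + C / \<delta> \<le> exp (\<delta> * h) * (V z + C / \<delta>)"
proof -
  define \<phi> where "\<phi> \<theta> = exp (- (\<delta> * h * \<theta>)) * (V (z + \<theta> *\<^sub>R \<Delta>) + C / \<delta>)" for \<theta>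
  have dV: "((\<lambda>\<theta>. V (z + \<theta> *\<^sub>R \<Delta>)) has_real_derivative inner (G (z + \<theta> *\<^sub>R \<Delta>)) \<Delta>) (at \<theta>)" for \<theta>
  proof -
    have "((\<lambda>\<theta>. z + \<theta> *\<^sub>R \<Delta>) has_derivative (\<lambda>\<sigma>. \<sigma> *\<^sub>R \<Delta>)) (at \<theta>)"
      by (auto intro!: derivative_eq_intros)
    from has_derivative_compose[OF this grad[unfolded gderiv_def]]
    show ?thesis by (simp add: has_field_derivative_def inner_commute mult.commute[of _ "inner _ _"])
  qed
  have "\<phi> 1 \<le> \<phi> 0"
  proof (rule DERIV_nonpos_imp_nonincreasing[where f = \<phi> and a = 0 and b = 1])
    fix \<theta> :: real assume \<theta>: "0 \<le> \<theta>" "\<theta> \<le> 1"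
    have eq: "\<delta> * h * (V (z + \<theta> *\<^sub>R \<Delta>) + C / \<delta>) = h * (C + \<delta> * V (z + \<theta> *\<^sub>R \<Delta>))"
      using \<delta> by (simp add: field_simps)
    have "(\<phi> has_real_derivative exp (- (\<delta> * h * \<theta>)) *
        (inner (G (z + \<theta> *\<^sub>R \<Delta>)) \<Delta> - \<delta> * h * (V (z + \<theta> *\<^sub>R \<Delta>) + C / \<delta>))) (at \<theta>)"
      unfolding \<phi>_def by (auto intro!: derivative_eq_intros dV simp: algebra_simps)
    moreover have "exp (- (\<delta> * h * \<theta>)) *
        (inner (G (z + \<theta> *\<^sub>R \<Delta>)) \<Delta> - \<delta> * h * (V (z + \<theta> *\<^sub>R \<Delta>) + C / \<delta>)) \<le> 0"
      using le[OF \<theta>] unfolding eq by (intro mult_nonneg_nonpos) auto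
    ultimately show "\<exists>y. (\<phi> has_real_derivative y) (at \<theta>) \<and> y \<le> 0" by blast
  qed simp
  then have "exp (\<delta> * h) * (exp (- (\<delta> * h)) * (V (z + \<Delta>) + C / \<delta>)) \<le> exp (\<delta> * h) * (V z + C / \<delta>)"
    by (intro mult_left_mono) (auto simp: \<phi>_def)
  moreover have "exp (\<delta> * h) * (exp (- (\<delta> * h)) * (V (z + \<Delta>) + C / \<delta>)) = V (z + \<Delta>) + C / \<delta>"
    by (simp add: exp_minus)
  ultimately show ?thesis by simp
qed

locale lyapunov =
  fixes f :: "real^'d \<Rightarrow> real^'d" and V :: "real^'d \<Rightarrow> real" and G :: "real^'d \<Rightarrow> real^'d"
    and L lam\<^sub>0 C \<delta> :: real
  assumes grad: "\<And>z. GDERIV V z :> G z" and grad_le: "\<And>z. norm (G z) \<le> L"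
    and \<delta>_pos: "0 < \<delta>" and C_nonneg: "0 \<le> C" and V_nonneg: "\<And>z. 0 \<le> V z"
    and dissip: "\<And>z \<psi> \<eta>. norm \<psi> \<le> lam\<^sub>0 \<Longrightarrow> norm \<eta> \<le> lam\<^sub>0 \<Longrightarrow>
        inner (G z) ((mat 1 + \<psi>) *v f (z + \<eta>)) \<le> C + \<delta> * V z"
begin

lemma V_lip: "V y \<le> V y' + L * norm (y - y')"
proof -
  have L: "0 \<le> L" using grad_le[of 0] norm_ge_zero order_trans by blast
  have "norm (V y - V y') \<le> L * norm (y - y')"
  proof (rule lipschitz_of_derivative[where S = UNIV and f' = "\<lambda>z h. inner h (G z)"])
    show "norm (inner v (G z)) \<le> L * norm v" for z v
      using order_trans[OF Cauchy_Schwarz_ineq2[of v "G z"] mult_left_mono[OF grad_le norm_ge_zero]]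
      by (simp add: mult.commute)
  qed (use grad L in \<open>auto simp: gderiv_def\<close>)
  then show ?thesis by simp
qed

text \<open>The displacement \<open>\<Delta>\<close> of the transformed path is \<open>(I + \<psi>) h f(w)\<close> for a rank-one matrix
  \<open>\<psi>\<close>, whose Frobenius norm is the relative error of \<open>\<Delta>\<close> with respect to \<open>h f(w)\<close>.\<close>

lemma drift_step:
  assumes h: "0 < h" "h \<le> H"
    and \<Delta>: "norm (\<Delta> - h *\<^sub>R f w) \<le> lam\<^sub>0 * norm (h *\<^sub>R f w)" and "0 \<le> lam\<^sub>0"
    and w: "norm (w - z) + norm \<Delta> \<le> lam\<^sub>0"
  shows "V (z + \<Delta>) + C / \<delta> \<le> exp (\<delta> * H) * (V z + C / \<delta>)"
proof -
  define e where "e = \<Delta> - h *\<^sub>R f w"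
  define \<psi> where "\<psi> = (1 / (h * (norm (f w))\<^sup>2)) *\<^sub>R tensor e (f w)"
  have \<psi>: "norm \<psi> \<le> lam\<^sub>0"
  \<comment> \<open>For f w = 0 the matrix \<psi> is zero.\<close>
  proof (cases "f w = 0")
    case False
    have "norm \<psi> = norm e / (h * norm (f w))"
      using False h by (simp add: \<psi>_def norm_tensor power2_eq_square)
    also have "\<dots> \<le> lam\<^sub>0" using \<Delta> False h by (simp add: e_def field_simps)
    finally show ?thesis .
  qed (simp add: \<psi>_def assms)
  have \<psi>f: "h *\<^sub>R ((mat 1 + \<psi>) *v f w) = \<Delta>"
  proof (cases "f w = 0")
    case True
    then show ?thesis using \<Delta> by simp
  next
    case False
    have "\<psi> *v f w = (1 / h) *\<^sub>R e"
      using False h unfolding \<psi>_def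
      by (simp add: scaleR_matrix_vector_assoc[symmetric] tensor_mult_vec power2_norm_eq_inner)
    then show ?thesis
      using h by (simp add: matrix_vector_mult_add_rdistrib scaleR_add_right e_def)
  qed
  have "V (z + \<Delta>) + C / \<delta> \<le> exp (\<delta> * h) * (V z + C / \<delta>)"
  proof (rule gronwall_segment[OF grad \<delta>_pos])
    fix \<theta> :: real assume \<theta>: "0 \<le> \<theta>" "\<theta> \<le> 1"
    define u where "u = z + \<theta> *\<^sub>R \<Delta>"
    \<comment> \<open>While u runs along the segment, w stays fixed; w - u is the admissible shift
      of the Lyapunov condition at u.\<close>
    have "norm (w - u) \<le> norm (w - z) + norm (\<theta> *\<^sub>R \<Delta>)"
      using norm_triangle_ineq4[of "w - z" "\<theta> *\<^sub>R \<Delta>"] by (simp add: u_def algebra_simps)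
    also have "\<dots> \<le> lam\<^sub>0" using w \<theta> mult_left_le_one_le[of "norm \<Delta>" \<theta>] by simp
    finally have "inner (G u) ((mat 1 + \<psi>) *v f w) \<le> C + \<delta> * V u"
      using dissip[OF \<psi>, of "w - u" u] by simp
    then have "h * inner (G u) ((mat 1 + \<psi>) *v f w) \<le> h * (C + \<delta> * V u)"
      using h by (intro mult_left_mono) auto
    then have "inner (G u) (h *\<^sub>R ((mat 1 + \<psi>) *v f w)) \<le> h * (C + \<delta> * V u)" by simp
    then show "inner (G (z + \<theta> *\<^sub>R \<Delta>)) \<Delta> \<le> h * (C + \<delta> * V (z + \<theta> *\<^sub>R \<Delta>))"
      unfolding \<psi>f by (simp add: u_def)
  qed
  \<comment> \<open>The tamed step is replaced by the larger grid step, since V + C / \<delta> is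
    nonnegative.\<close>
  also have "\<dots> \<le> exp (\<delta> * H) * (V z + C / \<delta>)"
    using h \<delta>_pos C_nonneg V_nonneg[of z] by (intro mult_right_mono) auto
  finally show ?thesis .
qed

text \<open>Discrete Doss--Sussmann transformation: the scheme is written as \<open>y k = \<Phi> k z\<close> with \<open>\<Phi> k\<close>
  the flow of the driftless scheme, and \<open>z\<close> moves only by the drift.\<close>

lemma doss_sussmann_interval:
  fixes \<Phi> S :: "nat \<Rightarrow> real^'d \<Rightarrow> real^'d" and y :: "nat \<Rightarrow> real^'d" and h t :: "nat \<Rightarrow> real"
  assumes \<Phi>: "\<And>z. \<Phi> a z = z" "\<And>k z. a \<le> k \<Longrightarrow> \<Phi> (Suc k) z = \<Phi> k z + S k (\<Phi> k z)"
    and \<Phi>_bound: "\<And>k z. a \<le> k \<Longrightarrow> k \<le> b \<Longrightarrow> norm (\<Phi> k z - z) \<le> 4 * lam"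
    and \<Phi>_lip: "\<And>k z z'. a \<le> k \<Longrightarrow> k \<le> b \<Longrightarrow>
        norm ((\<Phi> k z - z) - (\<Phi> k z' - z')) \<le> lam * norm (z - z')"
    and y: "\<And>k. y (Suc k) = y k + h k *\<^sub>R f (y k) + S k (y k)"
    and h: "\<And>k. 0 < h k" "\<And>k. h k \<le> t (Suc k) - t k" "\<And>k. norm (h k *\<^sub>R f (y k)) \<le> B"
    and lam: "0 < lam" "lam \<le> 1/2" "4 * lam + (1 + 4 * lam) * B \<le> lam\<^sub>0"
    and "a \<le> b"
  shows "V (y b) + C / \<delta> \<le> exp (\<delta> * (t b - t a)) * (V (y a) + C / \<delta>) + L * (4 * lam)"
proof -
  have B: "0 \<le> B" using h(3) norm_ge_zero order_trans by blast
  have lam0: "4 * lam \<le> lam\<^sub>0" using lam B mult_nonneg_nonneg[of "1 + 4 * lam" B] by linarith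
  have "\<exists>z. \<Phi> k z = y k \<and> V z + C / \<delta> \<le> exp (\<delta> * (t k - t a)) * (V (y a) + C / \<delta>)"
    if "a \<le> k" "k \<le> b" for k
    using that
  proof (induction k rule: dec_induct)
    case base
    then show ?case by (simp add: \<Phi>)
  next
    case (step k)
    then obtain z where z: "\<Phi> k z = y k"
        "V z + C / \<delta> \<le> exp (\<delta> * (t k - t a)) * (V (y a) + C / \<delta>)" by auto
    define \<rho> where "\<rho> u = \<Phi> (Suc k) u - u" for u
    have \<rho>: "norm (\<rho> u - \<rho> v) \<le> lam * norm (u - v)" for u v
      using \<Phi>_lip[of "Suc k" u v] step by (simp add: \<rho>_def)
    obtain z' where z': "\<Phi> (Suc k) z' = y (Suc k)"
      using perturbed_identity_surj[OF _ _ \<rho>, of "y (Suc k)"] lam by (auto simp: \<rho>_def)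
    define F where "F = h k *\<^sub>R f (y k)"
    define \<Delta> where "\<Delta> = z' - z"
    \<comment> \<open>Both images contain the same noise increment at \<open>y k\<close>; it cancels
      and only the drift is left.\<close>
    have "\<Phi> (Suc k) z' - \<Phi> (Suc k) z = F"
      using step by (simp add: z' y \<Phi>(2) z(1) F_def)
    then have \<Delta>F: "\<Delta> - F = \<rho> z - \<rho> z'" by (auto simp: \<Delta>_def \<rho>_def algebra_simps)
    have e: "norm (\<Delta> - F) \<le> lam * norm \<Delta>"
      unfolding \<Delta>F using \<rho>[of z z'] by (simp add: \<Delta>_def norm_minus_commute)
    have "norm \<Delta> \<le> norm F + norm (\<Delta> - F)" using norm_triangle_sub[of \<Delta> F] by simp
    \<comment> \<open>With lam <= 1/2 this gives norm \<Delta> <= 2 norm F, hence a relative error 2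
      lam, weakened to 4 lam to fit the assumption on \<open>lam\<^sub>0\<close>.\<close>
    then have \<Delta>1: "(1 - lam) * norm \<Delta> \<le> norm F" using e by (simp add: algebra_simps)
    have "(1/2) * norm \<Delta> \<le> (1 - lam) * norm \<Delta>" using lam by (intro mult_right_mono) auto
    then have \<Delta>2: "norm \<Delta> \<le> 2 * norm F" using \<Delta>1 by simp
    have "lam * norm \<Delta> \<le> lam * (2 * norm F)" using \<Delta>2 lam by (intro mult_left_mono) auto
    also have "\<dots> \<le> (4 * lam) * norm F" using lam by simp
    finally have e4: "norm (\<Delta> - F) \<le> (4 * lam) * norm F" using e by simp
    have FB: "norm F \<le> B" using h(3) by (simp add: F_def)
    have "norm \<Delta> \<le> (1 + 4 * lam) * norm F"
      using norm_triangle_sub[of \<Delta> F] e4 by (simp add: algebra_simps)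
    also have "\<dots> \<le> (1 + 4 * lam) * B" using FB lam by (intro mult_left_mono) auto
    finally have \<Delta>B: "norm \<Delta> \<le> (1 + 4 * lam) * B" .
    have "V (z + \<Delta>) + C / \<delta> \<le> exp (\<delta> * (t (Suc k) - t k)) * (V z + C / \<delta>)"
    proof (rule drift_step[OF h(1,2)])
      show "norm (\<Delta> - h k *\<^sub>R f (y k)) \<le> lam\<^sub>0 * norm (h k *\<^sub>R f (y k))"
        using order_trans[OF e4 mult_right_mono[OF lam0 norm_ge_zero]] by (simp add: F_def)
      show "norm (y k - z) + norm \<Delta> \<le> lam\<^sub>0"
        using \<Phi>_bound[of k z] step \<Delta>B lam z by simp
    qed (use lam lam0 in simp)
    also have "\<dots> \<le> exp (\<delta> * (t (Suc k) - t k)) * (exp (\<delta> * (t k - t a)) * (V (y a) + C / \<delta>))"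
      by (intro mult_left_mono z) simp
    also have "\<dots> = exp (\<delta> * (t (Suc k) - t a)) * (V (y a) + C / \<delta>)"
      by (simp add: mult_exp_exp right_diff_distrib flip: mult.assoc)
    finally show ?case using z' by (auto simp: \<Delta>_def intro!: exI[of _ z'])
  qed
  from this[OF \<open>a \<le> b\<close> order_refl]
  obtain z where z: "\<Phi> b z = y b" "V z + C / \<delta> \<le> exp (\<delta> * (t b - t a)) * (V (y a) + C / \<delta>)"
    by blast
  \<comment> \<open>The return from z to y is paid once, at the end of the interval, and not at
    every grid step.\<close>
  have "L * norm (y b - z) \<le> L * (4 * lam)"
    using \<Phi>_bound[of b z] z \<open>a \<le> b\<close> grad_le[of 0] norm_ge_zero[of "G 0"]
    by (intro mult_left_mono) (auto simp del: norm_ge_zero)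
  then show ?thesis using V_lip[of "y b" z] z by simp
qed

end

subsection \<open>The tamed scheme\<close>

lemma next_stop_cases:
  assumes "k < K"
  shows "k < next_stop p x X ts K \<gamma> k" "next_stop p x X ts K \<gamma> k \<le> K"
    and "next_stop p x X ts K \<gamma> k = Suc k
      \<or> rough_dvar p x X (range ts) (ts k) (ts (next_stop p x X ts K \<gamma> k)) \<le> \<gamma>"
proof -
  define U where "U = {l. k < l \<and> l \<le> K \<and> rough_dvar p x X (range ts) (ts k) (ts l) \<le> \<gamma>}"
  have fin: "finite U" by (auto simp: U_def)
  have "Max U \<in> U" if "\<not> rough_dvar p x X (range ts) (ts k) (ts (Suc k)) > \<gamma>"
  proof -
    have "Suc k \<in> U" using assms that by (simp add: U_def)
    then show ?thesis using Max_in[OF fin] by blast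
  qed
  moreover have "next_stop p x X ts K \<gamma> k
      = (if rough_dvar p x X (range ts) (ts k) (ts (Suc k)) > \<gamma> then Suc k else Max U)"
    using assms by (simp add: next_stop_def U_def)
  ultimately show "k < next_stop p x X ts K \<gamma> k" "next_stop p x X ts K \<gamma> k \<le> K"
    "next_stop p x X ts K \<gamma> k = Suc k
      \<or> rough_dvar p x X (range ts) (ts k) (ts (next_stop p x X ts K \<gamma> k)) \<le> \<gamma>"
    using assms by (auto simp: U_def)
qed

text \<open>Before \<open>K\<close> every stop advances by at least one index, so \<open>K\<close>
  is reached and the \<open>LEAST\<close> in \<open>stop_count\<close> is attained.\<close>

lemma stop_idx_bounds: "min n K \<le> stop_idx p x X ts K \<gamma> n \<and> stop_idx p x X ts K \<gamma> n \<le> K"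
proof (induction n)
  case (Suc n)
  show ?case
  proof (cases "stop_idx p x X ts K \<gamma> n < K")
    case True
    then show ?thesis using next_stop_cases(1,2)[OF True, of p x X ts \<gamma>] Suc by auto
  next
    case False
    then show ?thesis using Suc by (simp add: next_stop_def)
  qed
qed simp

lemma stop_idx_stop_count: "stop_idx p x X ts K \<gamma> (stop_count p x X ts K \<gamma>) = K"
proof -
  have "stop_idx p x X ts K \<gamma> K = K" using stop_idx_bounds[of K K p x X ts \<gamma>] by simp
  then show ?thesis unfolding stop_count_def by (rule LeastI)
qed

lemma rough_norm_le_max_jump:
  assumes "strict_mono ts" "ts 0 = 0" "k < K"
  shows "rough_norm p x X (ts k) (ts (Suc k)) \<le> max_jump p x X ts 0 (ts K)"
proof -
  have ts: "ts i < ts j \<longleftrightarrow> i < j" "ts i \<le> ts j \<longleftrightarrow> i \<le> j" for i j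
    using strict_mono_less[OF assms(1)] strict_mono_less_eq[OF assms(1)] by auto
  have ts0: "0 \<le> ts i" for i using ts(2)[of 0 i] assms(2) by simp
  have "{rough_norm p x X (ts k) (ts (Suc k)) | k. 0 \<le> ts k \<and> ts k < ts K}
      = (\<lambda>k. rough_norm p x X (ts k) (ts (Suc k))) ` {..<K}"
    using ts0 by (auto simp: ts)
  moreover have "0 \<noteq> ts K" using ts(1)[of 0 K] assms by auto
  ultimately show ?thesis using assms(3) by (auto simp: max_jump_def intro!: Max_ge)
qed

text \<open>Each additive cost \<open>J\<close> may be moved under the exponential, which is at
  least 1.\<close>

lemma iterate_growth:
  fixes W :: "nat \<Rightarrow> real" and t :: "nat \<Rightarrow> real" and \<sigma> :: "nat \<Rightarrow> nat"
  assumes step: "\<And>n. W (\<sigma> (Suc n)) \<le> exp (\<delta> * (t (\<sigma> (Suc n)) - t (\<sigma> n))) * W (\<sigma> n) + J"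
    and "\<sigma> 0 = 0" "t 0 = 0" "\<And>k. 0 \<le> t k" "0 \<le> \<delta>" "0 \<le> J"
  shows "W (\<sigma> n) \<le> exp (\<delta> * t (\<sigma> n)) * (W 0 + J * real n)"
proof (induction n)
  case (Suc n)
  have "W (\<sigma> (Suc n)) \<le> exp (\<delta> * (t (\<sigma> (Suc n)) - t (\<sigma> n))) * (exp (\<delta> * t (\<sigma> n)) * (W 0 + J * real n)) + J"
    by (rule order_trans[OF step add_right_mono[OF mult_left_mono[OF Suc]]]) simp
  also have "\<dots> = (exp (\<delta> * (t (\<sigma> (Suc n)) - t (\<sigma> n))) * exp (\<delta> * t (\<sigma> n))) * (W 0 + J * real n) + J"
    by (simp only: mult.assoc)
  also have "exp (\<delta> * (t (\<sigma> (Suc n)) - t (\<sigma> n))) * exp (\<delta> * t (\<sigma> n)) = exp (\<delta> * t (\<sigma> (Suc n)))"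
    by (simp add: mult_exp_exp right_diff_distrib)
  finally have "W (\<sigma> (Suc n)) \<le> exp (\<delta> * t (\<sigma> (Suc n))) * (W 0 + J * real n) + J" .
  moreover have "J \<le> exp (\<delta> * t (\<sigma> (Suc n))) * J"
    using mult_right_mono[of 1 "exp (\<delta> * t (\<sigma> (Suc n)))" J] assms by simp
  ultimately have "W (\<sigma> (Suc n)) \<le> exp (\<delta> * t (\<sigma> (Suc n))) * (W 0 + J * real n)
      + exp (\<delta> * t (\<sigma> (Suc n))) * J" by linarith
  then show ?case by (simp add: distrib_left add.assoc add.commute)
qed (simp add: assms)

section \<open>Growth of the tamed scheme\<close>

locale tamed_scheme = C3_coefficient g Dg D2g D3g c + lyapunov f V G L lam\<^sub>0 C \<delta>
  for g :: "real^'d \<Rightarrow> real^'m^'d" and Dg D2g D3g c and f V G L lam\<^sub>0 C \<delta> +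
  fixes p s lam M :: real and ts :: "nat \<Rightarrow> real" and x :: "real \<Rightarrow> real^'m"
    and X :: "real \<Rightarrow> real \<Rightarrow> real^'m^'m" and y\<^sub>0 y
  assumes c_pos: "0 < c" and p: "0 < p" "p < 3" and s: "s = 1 - 2 * (1/2) powr (3/p)"
    and lam: "0 < lam" "lam \<le> 1/8" "0 < M" "4 * lam + (1 + 4 * lam) / M \<le> lam\<^sub>0"
    and grid: "time_grid ts" and rough: "rough_path p x X"
    and sol: "tamed_solution f g Dg M ts x X y\<^sub>0 y"
begin

lemma s_pos: "0 < s" and s_le: "s \<le> 1"
proof -
  have "(1/2::real) powr (3/p) < (1/2) powr 1" using p by (intro powr_less_mono') auto
  then show "0 < s" "s \<le> 1" by (auto simp: s)
qed

lemma ts_mono: "strict_mono ts" and ts_zero: "ts 0 = 0"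
  using grid by (auto simp: time_grid_def)

lemma ts_nonneg: "0 \<le> ts k"
  using strict_mono_less_eq[OF ts_mono, of 0 k] ts_zero by simp

definition h where "h k = (ts (Suc k) - ts k) / (1 + M * norm (f (y k)) * (ts (Suc k) - ts k))"

lemma
  shows h_pos: "0 < h k" and h_le: "h k \<le> ts (Suc k) - ts k"
    and drift_le: "norm (h k *\<^sub>R f (y k)) \<le> 1 / M"
proof -
  define d where "d = ts (Suc k) - ts k"
  have d: "0 < d" using strict_mono_less[OF ts_mono, of k "Suc k"] by (simp add: d_def)
  have den: "1 \<le> 1 + M * norm (f (y k)) * d" using d lam by simp
  then have den0: "0 < 1 + M * norm (f (y k)) * d" by linarith
  have h: "h k = d / (1 + M * norm (f (y k)) * d)" by (simp add: h_def d_def)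
  show "0 < h k" using d den0 by (simp add: h)
  \<comment> \<open>Taming: d a / (1 + M a d) <= 1 / M for every a >= 0.\<close>
  then show "norm (h k *\<^sub>R f (y k)) \<le> 1 / M"
    using d den0 lam by (simp add: h field_simps)
  show "h k \<le> ts (Suc k) - ts k"
    using d den mult_left_mono[OF den, of d] den0 by (simp add: h divide_le_eq flip: d_def)
qed

lemma y_Suc: "y (Suc k) = y k + h k *\<^sub>R f (y k) + davie g Dg x X ts k (Suc k) (y k)"
  using sol by (simp add: tamed_solution_def h_def davie_def)

lemma M_le: "1 / M \<le> lam\<^sub>0"
proof -
  have "1 / M \<le> (1 + 4 * lam) / M" using lam by (intro divide_right_mono) auto
  then show ?thesis using lam by linarith
qed

text \<open>The variation may exceed the threshold here, so no flow is used. The step is cut into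
  pure drift, with zero matrix perturbation, and noise, which the largest jump bounds.\<close>

lemma big_step:
  assumes "k < K"
  defines "D \<equiv> max_jump p x X ts 0 (ts K)"
  shows "V (y (Suc k)) + C / \<delta>
    \<le> exp (\<delta> * (ts (Suc k) - ts k)) * (V (y k) + C / \<delta>) + L * (c * D + c\<^sup>2 * D\<^sup>2)"
proof -
  define z where "z = y k + h k *\<^sub>R f (y k)"
  have D: "rough_norm p x X (ts k) (ts (Suc k)) \<le> D"
    unfolding D_def by (rule rough_norm_le_max_jump[OF ts_mono ts_zero assms(1)])
  have 1: "c * norm (incr x (ts k) (ts (Suc k))) \<le> c * D"
    using order_trans[OF norm_le_rough_norm(1)[OF p(1)] D] c_nonneg by (intro mult_left_mono)
  have "norm (X (ts k) (ts (Suc k))) \<le> D\<^sup>2"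
    using norm_le_rough_norm(2)[OF p(1), of X "ts k" "ts (Suc k)" x] power_mono[OF D, of 2]
    by (simp add: rough_norm_def)
  then have 2: "c\<^sup>2 * norm (X (ts k) (ts (Suc k))) \<le> c\<^sup>2 * D\<^sup>2"
    by (intro mult_left_mono) auto
  have "norm (y (Suc k) - z) \<le> c * D + c\<^sup>2 * D\<^sup>2"
    using norm_triangle_mono[OF first_order_estimates(1)[OF 1] second_order_estimates(1)[OF 2]]
    by (simp add: y_Suc z_def davie_def)
  moreover have "0 \<le> L" using grad_le[of 0] norm_ge_zero order_trans by blast
  ultimately have "L * norm (y (Suc k) - z) \<le> L * (c * D + c\<^sup>2 * D\<^sup>2)" by (intro mult_left_mono)
  moreover have "V z + C / \<delta> \<le> exp (\<delta> * (ts (Suc k) - ts k)) * (V (y k) + C / \<delta>)"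
    unfolding z_def
  proof (rule drift_step[OF h_pos h_le])
    have "0 < 1 / M" using lam by simp
    then show "0 \<le> lam\<^sub>0" using M_le by linarith
    then show "norm (h k *\<^sub>R f (y k) - h k *\<^sub>R f (y k)) \<le> lam\<^sub>0 * norm (h k *\<^sub>R f (y k))" by simp
    show "norm (y k - y k) + norm (h k *\<^sub>R f (y k)) \<le> lam\<^sub>0" using drift_le[of k] M_le by simp
  qed
  ultimately show ?thesis using V_lip[of "y (Suc k)" z] by simp
qed

lemma small_interval:
  assumes "a \<le> b" and "rough_dvar p x X (range ts) (ts a) (ts b) \<le> lam / (12 / s * c)"
  shows "V (y b) + C / \<delta> \<le> exp (\<delta> * (ts b - ts a)) * (V (y a) + C / \<delta>) + L * (4 * lam)"
proof -
  \<comment> \<open>This is c times the threshold. Both the size and the Lipschitz constant of the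
    flow minus the identity are then at most 4 \<epsilon> <= lam / 3, and lam <= 1/8 gives
    \<epsilon> <= s / 96, hence the smallness conditions.\<close>
  define \<epsilon> where "\<epsilon> = lam * s / 12"
  have \<epsilon>_pos: "0 < \<epsilon>" using lam s_pos by (simp add: \<epsilon>_def)
  have \<epsilon>_lam: "\<epsilon> \<le> lam / 12" using lam s_le mult_left_mono[of s 1 lam] by (simp add: \<epsilon>_def)
  have \<epsilon>_s: "\<epsilon> \<le> s / 96" using lam s_pos mult_right_mono[of lam "1/8" s] by (simp add: \<epsilon>_def)
  have "\<epsilon> * \<epsilon> \<le> (s / 96) * 1" using \<epsilon>_s \<epsilon>_lam \<epsilon>_pos lam s_pos by (intro mult_mono) auto
  then have small: "12 * \<epsilon> \<le> s" "92 * \<epsilon>\<^sup>2 \<le> s" "\<epsilon> \<le> 1/4"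
    using \<epsilon>_s \<epsilon>_lam lam s_pos by (auto simp: power2_eq_square)
  have "c * rough_dvar p x X (range ts) (ts a) (ts b) \<le> c * (lam / (12 / s * c))"
    using assms(2) c_pos by (intro mult_left_mono) auto
  also have "\<dots> = \<epsilon>" using c_pos by (simp add: \<epsilon>_def)
  finally have R: "c * rough_dvar p x X (range ts) (ts a) (ts b) \<le> \<epsilon>" .
  have chen: "X s t - X s u - X u t = tensor (incr x s u) (incr x u t)"
    if "0 \<le> s" "s \<le> u" "u \<le> t" for s u t
    using rough that by (simp add: rough_path_def)
  have ts0: "0 \<le> ts 0" using ts_zero by simp
  interpret AF: almost_flow "davie g Dg x X ts"
    "\<lambda>k l. (c * rough_dvar p x X (range ts) (ts k) (ts l))^3" a b "2 * \<epsilon>" "(1/2) powr (3/p)" s 23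
    by (rule almost_flow_davie(1)[OF ts_mono ts0 p chen assms(1) R s small \<epsilon>_pos])
  show ?thesis
  proof (rule doss_sussmann_interval[where \<Phi> = "AF.flow a" and S = "\<lambda>k. davie g Dg x X ts k (Suc k)"
        and h = h and B = "1 / M"])
    show "AF.flow a a z = z" for z by (rule AF.flow_same)
    show "AF.flow a (Suc k) z = AF.flow a k z + davie g Dg x X ts k (Suc k) (AF.flow a k z)"
      if "a \<le> k" for k z
      by (rule AF.flow_Suc[OF that])
    show "norm (AF.flow a k z - z) \<le> 4 * lam" if "a \<le> k" "k \<le> b" for k z
      using AF.flow_minus_id_bound[OF order_refl that, of z]
        almost_flow_davie(2)[OF ts_mono ts0 p chen assms(1) R s small \<epsilon>_pos order_refl that, of z]
        \<epsilon>_lam lam by simp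
    show "norm ((AF.flow a k z - z) - (AF.flow a k z' - z')) \<le> lam * norm (z - z')"
      if "a \<le> k" "k \<le> b" for k z z'
    proof -
      have "2 * (2 * \<epsilon>) * norm (z - z') \<le> lam * norm (z - z')"
        using \<epsilon>_lam lam by (intro mult_right_mono) auto
      then show ?thesis using AF.flow_minus_id_lip[OF order_refl that, of z z'] by linarith
    qed
    show "4 * lam + (1 + 4 * lam) * (1 / M) \<le> lam\<^sub>0" using lam by simp
  qed (use y_Suc h_pos h_le drift_le lam assms(1) in auto)
qed

lemma tamed_growth:
  "V (y K) + C / \<delta> \<le> exp (\<delta> * ts K) * (V y\<^sub>0 + C / \<delta> + H_bound p (12 / s) L lam c x X ts K)"
proof -
  define D where "D = max_jump p x X ts 0 (ts K)"
  \<comment> \<open>\<open>J\<close> dominates the cost of either kind of stop, so it suffices to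
    count the stops.\<close>
  define J where "J = L * (4 * lam + c * D + c\<^sup>2 * D\<^sup>2)"
  define \<gamma> where "\<gamma> = lam / (12 / s * c)"
  define \<sigma> where "\<sigma> = stop_idx p x X ts K \<gamma>"
  have L: "0 \<le> L" using grad_le[of 0] norm_ge_zero order_trans by blast
  have D0: "0 \<le> D"
  proof (cases "K = 0")
    case False
    then have "rough_norm p x X (ts 0) (ts (Suc 0)) \<le> D"
      unfolding D_def by (intro rough_norm_le_max_jump[OF ts_mono ts_zero]) simp
    moreover have "0 \<le> rough_norm p x X (ts 0) (ts (Suc 0))" by (simp add: rough_norm_def)
    ultimately show ?thesis by linarith
  qed (simp add: D_def max_jump_def ts_zero)
  have J1: "L * (4 * lam) \<le> J" and J2: "L * (c * D + c\<^sup>2 * D\<^sup>2) \<le> J"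
    unfolding J_def using L D0 c_nonneg lam by (auto intro!: mult_left_mono)
  have J0: "0 \<le> J" using J1 L lam by (meson mult_nonneg_nonneg order_trans less_imp_le zero_le_numeral)
  have "V (y (\<sigma> n)) + C / \<delta> \<le> exp (\<delta> * ts (\<sigma> n)) * (V (y 0) + C / \<delta> + J * real n)" for n
  proof (rule iterate_growth[where W = "\<lambda>k. V (y k) + C / \<delta>"])
    fix n
    show "V (y (\<sigma> (Suc n))) + C / \<delta>
      \<le> exp (\<delta> * (ts (\<sigma> (Suc n)) - ts (\<sigma> n))) * (V (y (\<sigma> n)) + C / \<delta>) + J"
    proof (cases "\<sigma> n < K")
      case False
      then have "\<sigma> (Suc n) = \<sigma> n" by (simp add: \<sigma>_def next_stop_def)
      then show ?thesis using J0 by simp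
    next
      case True
      have S: "\<sigma> (Suc n) = next_stop p x X ts K \<gamma> (\<sigma> n)" by (simp add: \<sigma>_def)
      note ns = next_stop_cases[OF True, of p x X ts \<gamma>, folded S]
      from ns(3) show ?thesis
      proof
        assume "\<sigma> (Suc n) = Suc (\<sigma> n)"
        then show ?thesis using big_step[OF True] J2 by (simp add: D_def)
      next
        assume "rough_dvar p x X (range ts) (ts (\<sigma> n)) (ts (\<sigma> (Suc n))) \<le> \<gamma>"
        then show ?thesis using small_interval[of "\<sigma> n" "\<sigma> (Suc n)"] ns(1) J1 by (simp add: \<gamma>_def)
      qed
    qed
  qed (use ts_zero ts_nonneg \<delta>_pos J0 in \<open>auto simp: \<sigma>_def\<close>)
  from this[of "stop_count p x X ts K \<gamma>"] show ?thesis
    using sol stop_idx_stop_count[of p x X ts K \<gamma>]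
    by (simp add: \<sigma>_def H_bound_def J_def D_def \<gamma>_def tamed_solution_def)
qed

end

theorem theorem7:
  fixes \<nu> p :: real
  assumes "1/3 < \<nu>" "\<nu> \<le> 1/2" "1/\<nu> < p" "p < 3"
  shows "\<exists>C\<^sub>p\<ge>1.
    \<forall>(f :: real^'d \<Rightarrow> real^'d) (g :: real^'d \<Rightarrow> real^'m^'d) Dg D2g D3g
     (V :: real^'d \<Rightarrow> real) L_V lam\<^sub>0 C\<^sub>0 \<delta> C\<^sub>g lam M.
      locally_lipschitz f \<longrightarrow>
      C3_bounded g Dg D2g D3g \<longrightarrow>
      C\<^sub>g = C3_const g Dg D2g D3g \<longrightarrow> C\<^sub>g > 0 \<longrightarrow>
      strong_lyapunov f V L_V lam\<^sub>0 C\<^sub>0 \<delta> \<longrightarrow>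
      lam > 0 \<longrightarrow> M > 0 \<longrightarrow> lam \<le> 1/8 \<longrightarrow> 4 * lam + (1 + 4 * lam) / M \<le> lam\<^sub>0 \<longrightarrow>
      (\<forall>(ts :: nat \<Rightarrow> real) (x :: real \<Rightarrow> real^'m) (X :: real \<Rightarrow> real \<Rightarrow> real^'m^'m) y\<^sub>0 y.
        time_grid ts \<longrightarrow>
        rough_path p x X \<longrightarrow>
        tamed_solution f g Dg M ts x X y\<^sub>0 y \<longrightarrow>
        (let C_bar = C\<^sub>0 / \<delta> + L_V * lam\<^sub>0 in
          \<forall>K. V (y K) + C_bar
              \<le> exp (\<delta> * ts K) * (V y\<^sub>0 + C_bar + H_bound p C\<^sub>p L_V lam C\<^sub>g x X ts K)))"
proof -
  have "0 < 1 / \<nu>" using assms by simp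
  then have p: "0 < p" using assms by linarith
  define s where "s = 1 - 2 * (1/2) powr (3/p)"
  have "(1/2::real) powr (3/p) < (1/2) powr 1" using p assms by (intro powr_less_mono') auto
  then have s: "0 < s" "s \<le> 1" by (auto simp: s_def)
  show ?thesis
  \<comment> \<open>The witness is fixed before all other data and depends on p only.\<close>
  proof (intro exI[of _ "12 / s"] conjI allI impI)
    show "1 \<le> 12 / s" using s by (simp add: field_simps)
    fix f :: "real^'d \<Rightarrow> real^'d" and g :: "real^'d \<Rightarrow> real^'m^'d" and Dg D2g D3g
      and V :: "real^'d \<Rightarrow> real" and L_V lam\<^sub>0 C\<^sub>0 \<delta> c lam M :: real
      and ts :: "nat \<Rightarrow> real" and x :: "real \<Rightarrow> real^'m" and X :: "real \<Rightarrow> real \<Rightarrow> real^'m^'m" and y\<^sub>0 y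
    assume C3: "C3_bounded g Dg D2g D3g" and c: "c = C3_const g Dg D2g D3g" "0 < c"
      and lyap: "strong_lyapunov f V L_V lam\<^sub>0 C\<^sub>0 \<delta>"
      and lam: "0 < lam" "0 < M" "lam \<le> 1/8" "4 * lam + (1 + 4 * lam) / M \<le> lam\<^sub>0"
      and data: "time_grid ts" "rough_path p x X" "tamed_solution f g Dg M ts x X y\<^sub>0 y"
    from lyap obtain G where G: "\<And>z. GDERIV V z :> G z" "\<And>z. norm (G z) \<le> L_V"
      "\<And>z \<psi> \<eta>. norm \<psi> \<le> lam\<^sub>0 \<Longrightarrow> norm \<eta> \<le> lam\<^sub>0 \<Longrightarrow>
        inner (G z) ((mat 1 + \<psi>) *v f (z + \<eta>)) \<le> C\<^sub>0 + \<delta> * V z"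
      unfolding strong_lyapunov_def by blast
    have pos: "0 < L_V" "0 < lam\<^sub>0" "0 < C\<^sub>0" "0 < \<delta>" "\<And>z. 0 \<le> V z"
      using lyap by (auto simp: strong_lyapunov_def)
    interpret tamed_scheme g Dg D2g D3g c f V G L_V lam\<^sub>0 C\<^sub>0 \<delta> p s lam M ts x X y\<^sub>0 y
      by unfold_locales
        (fact C3 C3_const_bounds[OF C3, folded c(1)] c(2) G pos less_imp_le[OF pos(3)] p assms(4) lam data s_def)+
    show "let C_bar = C\<^sub>0 / \<delta> + L_V * lam\<^sub>0 in \<forall>K. V (y K) + C_bar
        \<le> exp (\<delta> * ts K) * (V y\<^sub>0 + C_bar + H_bound p (12 / s) L_V lam c x X ts K)"
      unfolding Let_def
    proof
      fix K
      \<comment> \<open>Since the exponential is at least 1, the remaining part of the constant may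
        be added on both sides of \<open>tamed_growth\<close>.\<close>
      have "1 * (L_V * lam\<^sub>0) \<le> exp (\<delta> * ts K) * (L_V * lam\<^sub>0)"
        using pos ts_nonneg[of K] by (intro mult_right_mono) auto
      then show "V (y K) + (C\<^sub>0 / \<delta> + L_V * lam\<^sub>0)
        \<le> exp (\<delta> * ts K) * (V y\<^sub>0 + (C\<^sub>0 / \<delta> + L_V * lam\<^sub>0) + H_bound p (12 / s) L_V lam c x X ts K)"
        using tamed_growth[of K] by (simp add: algebra_simps)
    qed
  qed
qed

end
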